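(* Let $F(x,y_0,y_1,\ldots,y_n)\not\equiv 0$ be a polynomial with complex coefficients in $n+2$ variables, let $\delta=x\frac{d}{dx}$, and let $$\varphi=\sum_{k=0}^{\infty}c_kx^{s_k},\qquad c_k\in\mathbb{C},\quad s_0\prec s_1\prec\ldots\in\mathbb{C},\quad \lim_{k\to\infty}\mathrm{Re}\,s_k=+\infty,$$ be a generalized power series which formally satisfies the ordinary differential equation $F(x,y,\delta y,\ldots,\delta^n y)=0$. Suppose that $$\frac{\partial F}{\partial y_n}(x,\varphi,\delta\varphi,\ldots,\delta^n\varphi)\neq 0$$ (as a generalized power series) and that $$\mathrm{ord}\,\frac{\partial F}{\partial y_j}(x,\varphi,\delta\varphi,\ldots,\delta^n\varphi)\succeq \mathrm{ord}\,\frac{\partial F}{\partial y_n}(x,\varphi,\delta\varphi,\ldots,\delta^n\varphi),\qquad j=0,1,\ldots,n.$$ Then for any sector $S$ of sufficiently small radius with vertex at the origin and of opening less than $2\pi$, the series $\varphi$ converges uniformly in $S$.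
   Context: The total order $\prec$ on $\mathbb{C}$: $a\prec b$ iff $\mathrm{Re}\,a<\mathrm{Re}\,b$, or $\mathrm{Re}\,a=\mathrm{Re}\,b$ and $\mathrm{Im}\,a<\mathrm{Im}\,b$; $a\succeq b$ means $b\prec a$ or $a=b$. The operator $\delta$ acts termwise on generalized power series: $\delta^j\varphi=\sum_{k}c_ks_k^jx^{s_k}$. Products are formal, with $x^a x^b=x^{a+b}$; because $\mathrm{Re}\,s_k\to+\infty$, for any polynomial $G$ only finitely many terms contribute to each power $x^s$ in $G(x,\varphi,\delta\varphi,\ldots,\delta^n\varphi)$, and the exponents that occur are well ordered by $\prec$. "$\varphi$ formally satisfies the equation" means that all coefficients of the expansion of $F(x,\varphi,\delta\varphi,\ldots,\delta^n\varphi)$ in powers of $x$ vanish. The order $\mathrm{ord}$ of a nonzero generalized power series is its $\prec$-smallest exponent occurring with nonzero coefficient; for the zero series the order is regarded as $+\infty$, so that an inequality $\mathrm{ord}\,0\succeq\ldots$ holds automatically. In a sector $S$ with vertex at $0$ and opening less than $2\pi$, the terms $c_kx^{s_k}=c_k e^{s_k\log x}$ are regarded as single-valued holomorphic functions, for a fixed branch of $\log x$ on $S$. "Sufficiently small radius" means that, once the directions of the sector and the branch are fixed, the conclusion holds for all small enough values of the radius. *)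

theory Defs
  imports "HOL-Analysis.Analysis" "HOL-Library.Poly_Mapping"
begin

section \<open>The order on exponents\<close>

definition exp_less :: "complex \<Rightarrow> complex \<Rightarrow> bool"  (infix "\<prec>" 50)
  where "a \<prec> b \<longleftrightarrow> Re a < Re b \<or> (Re a = Re b \<and> Im a < Im b)"

definition exp_le :: "complex \<Rightarrow> complex \<Rightarrow> bool"  (infix "\<preceq>" 50)
  where "a \<preceq> b \<longleftrightarrow> a \<prec> b \<or> a = b"

abbreviation exp_ge :: "complex \<Rightarrow> complex \<Rightarrow> bool"  (infix "\<succeq>" 50)
  where "a \<succeq> b \<equiv> b \<preceq> a"

lemma exp_le_refl: "a \<preceq> a"
  by (simp add: exp_le_def)

lemma exp_le_trans: "a \<preceq> b \<Longrightarrow> b \<preceq> c \<Longrightarrow> a \<preceq> c"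
  by (auto simp: exp_le_def exp_less_def)

lemma exp_le_antisym: "a \<preceq> b \<Longrightarrow> b \<preceq> a \<Longrightarrow> a = b"
  by (auto simp: exp_le_def exp_less_def)

lemma exp_le_linear: "a \<preceq> b \<or> b \<preceq> a"
  by (auto simp: exp_le_def exp_less_def complex_eq_iff)

section \<open>Formal generalized power series\<close>

text \<open>
  A series is represented by its coefficient function, indexed by the exponents. The
  condition on the support says that the exponents can be listed as a finite or infinite sequence,
  increasing for \<open>\<prec>\<close>, whose real parts tend to infinity in the infinite case.
\<close>

typedef gpseries = "{f :: complex \<Rightarrow> complex. \<forall>R. finite {t. f t \<noteq> 0 \<and> Re t \<le> R}}"
  morphisms gcoeff Abs_gpseries
  by (rule exI[of _ "\<lambda>_. 0"]) simp

setup_lifting type_definition_gpseries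

lemma gpseries_eqI: "(\<And>t. gcoeff f t = gcoeff g t) \<Longrightarrow> f = g"
  by (simp add: gcoeff_inject[symmetric] fun_eq_iff)

lemma finite_gcoeff: "finite {t. gcoeff f t \<noteq> 0 \<and> Re t \<le> R}"
  using gcoeff[of f] by simp

lemma support_bounded_below:
  assumes "\<forall>R. finite {t. f t \<noteq> (0::complex) \<and> Re t \<le> R}"
  obtains m where "\<And>t. f t \<noteq> 0 \<Longrightarrow> m \<le> Re t"
proof -
  let ?A = "Re ` {t. f t \<noteq> 0 \<and> Re t \<le> 0}"
  have fin: "finite (insert 0 ?A)" using assms by blast
  have "Min (insert 0 ?A) \<le> Re t" if "f t \<noteq> 0" for t
  proof (cases "Re t \<le> 0")
    case True
    then show ?thesis using that by (intro Min_le[OF fin]) auto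
  next
    case False
    have "Min (insert 0 ?A) \<le> 0" by (intro Min_le[OF fin]) auto
    with False show ?thesis by simp
  qed
  then show thesis using that by blast
qed

lemma finite_factor_pairs:
  assumes f: "\<forall>R. finite {t. f t \<noteq> (0::complex) \<and> Re t \<le> R}"
    and g: "\<forall>R. finite {t. g t \<noteq> (0::complex) \<and> Re t \<le> R}"
  shows "finite {(t, u). f t \<noteq> 0 \<and> g u \<noteq> 0 \<and> Re (t + u) \<le> R}"
proof -
  obtain m where m: "\<And>t. f t \<noteq> 0 \<Longrightarrow> m \<le> Re t"
    by (rule support_bounded_below[OF f]) blast
  obtain k where k: "\<And>t. g t \<noteq> 0 \<Longrightarrow> k \<le> Re t"
    by (rule support_bounded_below[OF g]) blast
  have "{(t, u). f t \<noteq> 0 \<and> g u \<noteq> 0 \<and> Re (t + u) \<le> R}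
      \<subseteq> {t. f t \<noteq> 0 \<and> Re t \<le> R - k} \<times> {t. g t \<noteq> 0 \<and> Re t \<le> R - m}"
  proof
    fix p
    assume "p \<in> {(t, u). f t \<noteq> 0 \<and> g u \<noteq> 0 \<and> Re (t + u) \<le> R}"
    then obtain t u where p: "p = (t, u)" and tu: "f t \<noteq> 0" "g u \<noteq> 0" "Re (t + u) \<le> R"
      by blast
    have "Re t \<le> R - k" "Re u \<le> R - m" using tu m[of t] k[of u] by simp_all
    with p tu show "p \<in> {t. f t \<noteq> 0 \<and> Re t \<le> R - k} \<times> {t. g t \<noteq> 0 \<and> Re t \<le> R - m}"
      by simp
  qed
  moreover have "finite \<dots>" using f g by blast
  ultimately show ?thesis by (rule finite_subset)
qed

lemma finite_factors:
  assumes "\<forall>R. finite {t. f t \<noteq> (0::complex) \<and> Re t \<le> R}"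
    and "\<forall>R. finite {t. g t \<noteq> (0::complex) \<and> Re t \<le> R}"
  shows "finite {t. f t \<noteq> 0 \<and> g (s - t) \<noteq> 0}"
proof -
  have "{t. f t \<noteq> 0 \<and> g (s - t) \<noteq> 0}
      \<subseteq> fst ` {(t, u). f t \<noteq> 0 \<and> g u \<noteq> 0 \<and> Re (t + u) \<le> Re s}"
  proof
    fix t
    assume "t \<in> {t. f t \<noteq> 0 \<and> g (s - t) \<noteq> 0}"
    then have "(t, s - t) \<in> {(t, u). f t \<noteq> 0 \<and> g u \<noteq> 0 \<and> Re (t + u) \<le> Re s}" by simp
    then show "t \<in> fst ` {(t, u). f t \<noteq> 0 \<and> g u \<noteq> 0 \<and> Re (t + u) \<le> Re s}"
      by (rule rev_image_eqI) simp
  qed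
  then show ?thesis
    by (rule finite_subset) (intro finite_imageI finite_factor_pairs assms)
qed

lemma finite_support_plus:
  assumes "\<And>R. finite {t. f t \<noteq> (0::complex) \<and> Re t \<le> R}"
    and "\<And>R. finite {t. g t \<noteq> (0::complex) \<and> Re t \<le> R}"
  shows "finite {t. f t + g t \<noteq> 0 \<and> Re t \<le> R}"
proof -
  have "finite ({t. f t \<noteq> 0 \<and> Re t \<le> R} \<union> {t. g t \<noteq> 0 \<and> Re t \<le> R})" using assms by blast
  then show ?thesis by (rule rev_finite_subset) auto
qed

lemma finite_support_times:
  assumes f: "\<And>R. finite {t. f t \<noteq> (0::complex) \<and> Re t \<le> R}"
    and g: "\<And>R. finite {t. g t \<noteq> (0::complex) \<and> Re t \<le> R}"
  shows "finite {s. (\<Sum>t | f t \<noteq> 0 \<and> g (s - t) \<noteq> 0. f t * g (s - t)) \<noteq> 0 \<and> Re s \<le> R}"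
proof -
  let ?P = "{(t, u). f t \<noteq> 0 \<and> g u \<noteq> 0 \<and> Re (t + u) \<le> R}"
  have "{s. (\<Sum>t | f t \<noteq> 0 \<and> g (s - t) \<noteq> 0. f t * g (s - t)) \<noteq> 0 \<and> Re s \<le> R}
      \<subseteq> (\<lambda>(t, u). t + u) ` ?P"
  proof
    fix s
    assume s: "s \<in> {s. (\<Sum>t | f t \<noteq> 0 \<and> g (s - t) \<noteq> 0. f t * g (s - t)) \<noteq> 0 \<and> Re s \<le> R}"
    then have "{t. f t \<noteq> 0 \<and> g (s - t) \<noteq> 0} \<noteq> {}" by (auto simp del: Collect_empty_eq)
    then obtain t where "f t \<noteq> 0" "g (s - t) \<noteq> 0" by blast
    then have "(t, s - t) \<in> ?P" using s by simp
    then show "s \<in> (\<lambda>(t, u). t + u) ` ?P" by (rule rev_image_eqI) simp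
  qed
  moreover have "finite ?P" using f g by (intro finite_factor_pairs allI)
  ultimately show ?thesis by (blast intro: finite_subset)
qed

lemma finite_support_delta:
  assumes "\<And>R. finite {t. f t \<noteq> (0::complex) \<and> Re t \<le> R}"
  shows "finite {t. t * f t \<noteq> 0 \<and> Re t \<le> R}"
  using assms[of R] by (rule rev_finite_subset) auto

instantiation gpseries :: comm_ring_1
begin

lift_definition zero_gpseries :: gpseries is "\<lambda>_. 0"
  by simp

lift_definition one_gpseries :: gpseries is "\<lambda>t. if t = 0 then 1 else 0"
  by simp

lift_definition plus_gpseries :: "gpseries \<Rightarrow> gpseries \<Rightarrow> gpseries" is "\<lambda>f g t. f t + g t"
  by (rule finite_support_plus)

lift_definition uminus_gpseries :: "gpseries \<Rightarrow> gpseries" is "\<lambda>f t. - f t"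
  by simp

definition minus_gpseries :: "gpseries \<Rightarrow> gpseries \<Rightarrow> gpseries"
  where "minus_gpseries f g = f + - g"

text \<open>The sum below is over a finite set (see \<open>finite_factors\<close>).\<close>

lift_definition times_gpseries :: "gpseries \<Rightarrow> gpseries \<Rightarrow> gpseries"
  is "\<lambda>f g s. \<Sum>t | f t \<noteq> 0 \<and> g (s - t) \<noteq> 0. f t * g (s - t)"
  by (rule finite_support_times)

lemma gcoeff_times_eq:
  assumes "finite A" "{t. gcoeff f t \<noteq> 0 \<and> gcoeff g (s - t) \<noteq> 0} \<subseteq> A"
  shows "gcoeff (f * g) s = (\<Sum>t\<in>A. gcoeff f t * gcoeff g (s - t))"
  unfolding times_gpseries.rep_eq using assms by (intro sum.mono_neutral_left) auto

lemma finite_gcoeff_factors: "finite {t. gcoeff f t \<noteq> 0 \<and> gcoeff g (s - t) \<noteq> 0}"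
  using gcoeff[of f] gcoeff[of g] by (intro finite_factors) simp_all

lemma gpseries_mult_commute: "f * g = g * (f :: gpseries)"
proof (rule gpseries_eqI)
  fix s
  show "gcoeff (f * g) s = gcoeff (g * f) s"
    unfolding times_gpseries.rep_eq
    by (rule sum.reindex_bij_witness[of _ "\<lambda>t. s - t" "\<lambda>t. s - t"]) auto
qed

lemma gpseries_distrib: "(f + g) * h = f * h + g * (h :: gpseries)"
proof (rule gpseries_eqI)
  fix s
  let ?A = "{t. gcoeff f t \<noteq> 0 \<and> gcoeff h (s - t) \<noteq> 0}
          \<union> {t. gcoeff g t \<noteq> 0 \<and> gcoeff h (s - t) \<noteq> 0}"
  have A: "finite ?A" by (simp add: finite_gcoeff_factors)
  have "gcoeff ((f + g) * h) s = (\<Sum>t\<in>?A. gcoeff (f + g) t * gcoeff h (s - t))"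
    by (rule gcoeff_times_eq[OF A]) (auto simp: plus_gpseries.rep_eq)
  also have "\<dots> = (\<Sum>t\<in>?A. gcoeff f t * gcoeff h (s - t))
               + (\<Sum>t\<in>?A. gcoeff g t * gcoeff h (s - t))"
    by (simp add: plus_gpseries.rep_eq distrib_right sum.distrib)
  also have "(\<Sum>t\<in>?A. gcoeff f t * gcoeff h (s - t)) = gcoeff (f * h) s"
    by (rule gcoeff_times_eq[OF A, symmetric]) auto
  also have "(\<Sum>t\<in>?A. gcoeff g t * gcoeff h (s - t)) = gcoeff (g * h) s"
    by (rule gcoeff_times_eq[OF A, symmetric]) auto
  finally show "gcoeff ((f + g) * h) s = gcoeff (f * h + g * h) s"
    by (simp add: plus_gpseries.rep_eq)
qed

lemma gpseries_mult_one: "1 * f = (f :: gpseries)"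
proof (rule gpseries_eqI)
  fix s
  have "gcoeff (1 * f) s = (\<Sum>t\<in>{0}. gcoeff 1 t * gcoeff f (s - t))"
    by (rule gcoeff_times_eq) (auto simp: one_gpseries.rep_eq)
  then show "gcoeff (1 * f) s = gcoeff f s" by (simp add: one_gpseries.rep_eq)
qed

lemma gcoeff_times_nonzero:
  assumes "gcoeff (f * g) s \<noteq> 0"
  obtains t where "gcoeff f t \<noteq> 0" "gcoeff g (s - t) \<noteq> 0"
proof -
  have "\<exists>t. gcoeff f t \<noteq> 0 \<and> gcoeff g (s - t) \<noteq> 0"
  proof (rule ccontr)
    assume "\<not> ?thesis"
    then have e: "{t. gcoeff f t \<noteq> 0 \<and> gcoeff g (s - t) \<noteq> 0} = {}" by auto
    show False using assms unfolding times_gpseries.rep_eq e by simp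
  qed
  then show thesis using that by blast
qed

lemma gpseries_mult_assoc: "(f * g) * h = f * (g * (h :: gpseries))"
proof (rule gpseries_eqI)
  fix s
  obtain a where a: "\<And>t. gcoeff f t \<noteq> 0 \<Longrightarrow> a \<le> Re t"
    using support_bounded_below[of "gcoeff f"] finite_gcoeff by blast
  obtain b where b: "\<And>t. gcoeff g t \<noteq> 0 \<Longrightarrow> b \<le> Re t"
    using support_bounded_below[of "gcoeff g"] finite_gcoeff by blast
  obtain c where c: "\<And>t. gcoeff h t \<noteq> 0 \<Longrightarrow> c \<le> Re t"
    using support_bounded_below[of "gcoeff h"] finite_gcoeff by blast
  define A where "A = {t. gcoeff f t \<noteq> 0 \<and> Re t \<le> Re s - b - c}"
  define C where "C = {t. gcoeff h t \<noteq> 0 \<and> Re t \<le> Re s - a - b}"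
  have fin: "finite A" "finite C" unfolding A_def C_def by (rule finite_gcoeff)+
  have 1: "gcoeff (g * h) (s - t) = (\<Sum>u\<in>C. gcoeff h u * gcoeff g (s - t - u))"
    if "t \<in> A" for t
    unfolding gpseries_mult_commute[of g h]
  proof (rule gcoeff_times_eq[OF fin(2)])
    have "Re u \<le> Re s - a - b" if "gcoeff g (s - t - u) \<noteq> 0" for u
      using b[OF that] a[of t] \<open>t \<in> A\<close> by (simp add: A_def)
    then show "{u. gcoeff h u \<noteq> 0 \<and> gcoeff g (s - t - u) \<noteq> 0} \<subseteq> C"
      by (auto simp: C_def)
  qed
  have 2: "gcoeff (f * g) (s - u) = (\<Sum>t\<in>A. gcoeff f t * gcoeff g (s - u - t))"
    if "u \<in> C" for u
  proof (rule gcoeff_times_eq[OF fin(1)])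
    have "Re t \<le> Re s - b - c" if "gcoeff g (s - u - t) \<noteq> 0" for t
      using b[OF that] c[of u] \<open>u \<in> C\<close> by (simp add: C_def)
    then show "{t. gcoeff f t \<noteq> 0 \<and> gcoeff g (s - u - t) \<noteq> 0} \<subseteq> A"
      by (auto simp: A_def)
  qed
  have "gcoeff (f * (g * h)) s = (\<Sum>t\<in>A. gcoeff f t * gcoeff (g * h) (s - t))"
  proof (rule gcoeff_times_eq[OF fin(1)])
    have "Re t \<le> Re s - b - c" if nz: "gcoeff (g * h) (s - t) \<noteq> 0" for t
    proof -
      obtain u where u: "gcoeff g u \<noteq> 0" "gcoeff h (s - t - u) \<noteq> 0"
        using gcoeff_times_nonzero[OF nz] .
      show ?thesis using b[OF u(1)] c[OF u(2)] by simp
    qed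
    then show "{t. gcoeff f t \<noteq> 0 \<and> gcoeff (g * h) (s - t) \<noteq> 0} \<subseteq> A"
      by (auto simp: A_def)
  qed
  also have "\<dots> = (\<Sum>t\<in>A. \<Sum>u\<in>C. gcoeff h u * (gcoeff f t * gcoeff g (s - u - t)))"
    by (rule sum.cong) (simp_all add: 1 sum_distrib_left algebra_simps)
  also have "\<dots> = (\<Sum>u\<in>C. gcoeff h u * gcoeff (f * g) (s - u))"
    by (subst sum.swap) (simp add: 2 sum_distrib_left cong: sum.cong)
  also have "\<dots> = gcoeff (h * (f * g)) s"
  proof (rule gcoeff_times_eq[OF fin(2), symmetric])
    have "Re u \<le> Re s - a - b" if nz: "gcoeff (f * g) (s - u) \<noteq> 0" for u
    proof -
      obtain t where t: "gcoeff f t \<noteq> 0" "gcoeff g (s - u - t) \<noteq> 0"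
        using gcoeff_times_nonzero[OF nz] .
      show ?thesis using a[OF t(1)] b[OF t(2)] by simp
    qed
    then show "{u. gcoeff h u \<noteq> 0 \<and> gcoeff (f * g) (s - u) \<noteq> 0} \<subseteq> C"
      by (auto simp: C_def)
  qed
  finally show "gcoeff ((f * g) * h) s = gcoeff (f * (g * h)) s"
    by (simp add: gpseries_mult_commute[of h])
qed

instance
proof
  fix f g h :: gpseries
  show "f * g * h = f * (g * h)" by (rule gpseries_mult_assoc)
  show "f * g = g * f" by (rule gpseries_mult_commute)
  show "1 * f = f" by (rule gpseries_mult_one)
  show "(f + g) * h = f * h + g * h" by (rule gpseries_distrib)
  show "f - g = f + - g" by (rule minus_gpseries_def)
  show "(0::gpseries) \<noteq> 1" by transfer (auto simp: fun_eq_iff)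
  show "f + g + h = f + (g + h)" by transfer (simp add: add.assoc)
  show "f + g = g + f" by transfer (simp add: add.commute)
  show "0 + f = f" by transfer simp
  show "- f + f = 0" by transfer simp
qed

end

text \<open>The one-term series \<open>a x\<^sup>s\<close>.\<close>

lift_definition gmonom :: "complex \<Rightarrow> complex \<Rightarrow> gpseries"
  is "\<lambda>a s t. if t = s then a else 0"
  by simp

lift_definition gdelta :: "gpseries \<Rightarrow> gpseries" is "\<lambda>f t. t * f t"
  by (rule finite_support_delta)

text \<open>The series \<open>\<Sum>k. c k x\<^bsup>s k\<^esup>\<close>. Its value is meaningful when \<open>Re (s k)\<close> tends to infinity.\<close>

definition gseries :: "(nat \<Rightarrow> complex) \<Rightarrow> (nat \<Rightarrow> complex) \<Rightarrow> gpseries"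
  where "gseries c s = Abs_gpseries (\<lambda>t. \<Sum>k | s k = t. c k)"

lemma gcoeff_gseries:
  assumes "filterlim (\<lambda>k. Re (s k)) at_top sequentially"
  shows "gcoeff (gseries c s) t = (\<Sum>k | s k = t. c k)"
proof -
  have "finite {t. (\<Sum>k | s k = t. c k) \<noteq> 0 \<and> Re t \<le> R}" for R
  proof -
    have "eventually (\<lambda>k. R < Re (s k)) sequentially"
      using assms by (simp add: filterlim_at_top_dense)
    then obtain N where N: "\<And>k. k \<ge> N \<Longrightarrow> R < Re (s k)"
      by (auto simp: eventually_sequentially)
    have "{t. (\<Sum>k | s k = t. c k) \<noteq> 0 \<and> Re t \<le> R} \<subseteq> s ` {..<N}"
    proof
      fix t assume t: "t \<in> {t. (\<Sum>k | s k = t. c k) \<noteq> 0 \<and> Re t \<le> R}"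
      then obtain k where k: "s k = t"
        by (metis (mono_tags, lifting) mem_Collect_eq sum.neutral)
      then have "k < N" using N[of k] t by (force simp: not_less)
      with k show "t \<in> s ` {..<N}" by blast
    qed
    then show ?thesis by (rule finite_subset) simp
  qed
  then show ?thesis by (simp add: gseries_def Abs_gpseries_inverse)
qed

text \<open>The order of a nonzero series; the value at the zero series is unspecified.\<close>

definition gord :: "gpseries \<Rightarrow> complex"
  where "gord f = (THE s. gcoeff f s \<noteq> 0 \<and> (\<forall>t. gcoeff f t \<noteq> 0 \<longrightarrow> s \<preceq> t))"

lemma gord_nonzero:
  assumes "f \<noteq> 0"
  shows "gcoeff f (gord f) \<noteq> 0" and "\<And>t. gcoeff f t \<noteq> 0 \<Longrightarrow> gord f \<preceq> t"
proof -
  obtain t0 where t0: "gcoeff f t0 \<noteq> 0"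
    using assms gpseries_eqI[of f 0] by (auto simp: zero_gpseries.rep_eq)
  let ?A = "{t. gcoeff f t \<noteq> 0 \<and> Re t \<le> Re t0}"
  have min: "\<exists>a\<in>B. \<forall>t\<in>B. a \<preceq> t" if "finite B" "B \<noteq> {}" for B
    using that
  proof (induction B rule: finite_ne_induct)
    case (singleton x)
    then show ?case by (simp add: exp_le_refl)
  next
    case (insert x B)
    then show ?case by (metis exp_le_linear exp_le_refl exp_le_trans insert_iff)
  qed
  obtain a where a: "a \<in> ?A" "\<And>t. t \<in> ?A \<Longrightarrow> a \<preceq> t"
    using min[of ?A] finite_gcoeff t0 by blast
  have "a \<preceq> t" if "gcoeff f t \<noteq> 0" for t
  proof (cases "Re t \<le> Re t0")
    case True
    with that a show ?thesis by blast
  next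
    case False
    with a(1) show ?thesis by (auto simp: exp_le_def exp_less_def)
  qed
  with a(1) have "\<exists>!s. gcoeff f s \<noteq> 0 \<and> (\<forall>t. gcoeff f t \<noteq> 0 \<longrightarrow> s \<preceq> t)"
    using exp_le_antisym by blast
  from theI'[OF this]
  show "gcoeff f (gord f) \<noteq> 0" and "\<And>t. gcoeff f t \<noteq> 0 \<Longrightarrow> gord f \<preceq> t"
    by (simp_all add: gord_def)
qed

section \<open>Polynomials in several variables\<close>

text \<open>
  Polynomials are finitely supported families of coefficients indexed by monomials, and a
  monomial is a finitely supported family of exponents indexed by the variables. Variable \<open>0\<close>
  stands for \<open>x\<close> and variable \<open>Suc j\<close> for \<open>y\<^sub>j\<close>.
\<close>

type_synonym cpoly = "(nat \<Rightarrow>\<^sub>0 nat) \<Rightarrow>\<^sub>0 complex"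

definition cpoly_vars :: "cpoly \<Rightarrow> nat set"
  where "cpoly_vars F = (\<Union>m\<in>Poly_Mapping.keys F. Poly_Mapping.keys m)"

definition cpoly_pderiv :: "nat \<Rightarrow> cpoly \<Rightarrow> cpoly"
  where "cpoly_pderiv i F = (\<Sum>m\<in>Poly_Mapping.keys F.
    Poly_Mapping.single (m - Poly_Mapping.single i 1)
      (of_nat (Poly_Mapping.lookup m i) * Poly_Mapping.lookup F m))"

definition cpoly_eval :: "cpoly \<Rightarrow> (nat \<Rightarrow> gpseries) \<Rightarrow> gpseries"
  where "cpoly_eval F v = (\<Sum>m\<in>Poly_Mapping.keys F.
    gmonom (Poly_Mapping.lookup F m) 0 * (\<Prod>i\<in>Poly_Mapping.keys m. v i ^ Poly_Mapping.lookup m i))"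

text \<open>The values \<open>x, \<phi>, \<delta>\<phi>, \<delta>\<^sup>2\<phi>, \<dots>\<close> of the variables.\<close>

definition gjet :: "gpseries \<Rightarrow> nat \<Rightarrow> gpseries"
  where "gjet \<phi> i = (case i of 0 \<Rightarrow> gmonom 1 1 | Suc j \<Rightarrow> (gdelta ^^ j) \<phi>)"

section \<open>Sectors and branches of the logarithm\<close>

text \<open>
  The angles are not reduced modulo \<open>2 * pi\<close>, so all sectors with vertex at the origin are covered,
  also those meeting the negative real axis.
\<close>

definition open_cone :: "real \<Rightarrow> real \<Rightarrow> complex set"
  where "open_cone \<alpha> \<beta> = {of_real r * cis \<theta> | r \<theta>. 0 < r \<and> \<alpha> < \<theta> \<and> \<theta> < \<beta>}"

definition sector :: "real \<Rightarrow> real \<Rightarrow> real \<Rightarrow> complex set"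
  where "sector \<alpha> \<beta> \<rho> = open_cone \<alpha> \<beta> \<inter> ball 0 \<rho>"

definition log_branch_on :: "(complex \<Rightarrow> complex) \<Rightarrow> complex set \<Rightarrow> bool"
  where "log_branch_on L S \<longleftrightarrow> L holomorphic_on S \<and> (\<forall>x\<in>S. exp (L x) = x)"

end

theory Submission
  imports Defs
begin

text \<open>
  Split off the terms of real part at most \<open>T\<close>, so that \<open>\<phi> = \<phi>\<^sub>T + x\<^sup>T v\<close>, and put
  \<open>V\<^sub>j = (\<delta> + T)\<^sup>j v\<close>. Expanding \<open>F\<close> at \<open>\<phi>\<^sub>T\<close> and dividing by \<open>x\<^bsup>\<gamma> + T\<^esup>\<close>, where \<open>\<gamma>\<close> is the order of
  \<open>\<partial>F/\<partial>y\<^sub>n\<close> on \<open>\<phi>\<close>, gives a reduced equation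

  \<open>f + (\<Sum>j\<le>n. E\<^sub>j V\<^sub>j) + x\<^sup>\<kappa> S = 0\<close>

  in which \<open>f\<close> and the \<open>E\<^sub>j\<close> have finitely many terms, \<open>S\<close> is a polynomial in the \<open>V\<^sub>j\<close> and
  finitely many finite series, and \<open>Re \<kappa> \<ge> 1\<close> if \<open>T\<close> is large (\<open>tail_estimates\<close>). The condition on
  the orders says that the exponents of all \<open>E\<^sub>j\<close> are \<open>\<succeq> 0\<close> and that \<open>E\<^sub>n\<close> has a nonzero
  constant term. The constant terms therefore form a polynomial in \<open>\<delta> + T\<close> of exact degree \<open>n\<close>, which on
  the exponents of \<open>v\<close> dominates all powers \<open>(\<delta> + T)\<^sup>j\<close> with \<open>j \<le> n\<close>.

  For \<open>z = \<mu> + \<i> l\<close>, the sum of \<open>\<bar>v\<^sub>t exp (z t)\<bar>\<close> over the exponents \<open>t\<close> is the sum of the absolute values of the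
  terms at a point with \<open>log x = z\<close>; it is submultiplicative. The other terms of the \<open>E\<^sub>j\<close> have
  exponents \<open>\<succ> 0\<close>. Those of positive real part are small for \<open>\<mu>\<close> near \<open>-\<infinity>\<close>. Those on the
  imaginary axis are not, but they become small for a large argument \<open>l\<close>. Choosing first \<open>l\<close> and then \<open>\<mu>\<close>, the
  linear part is a small perturbation of its constant terms. As \<open>x\<^sup>\<kappa>\<close> raises real parts by at least
  \<open>1\<close>, the nonlinear part up to real part \<open>R\<close> depends on \<open>v\<close> up to \<open>R - 1\<close> only, and induction on
  \<open>R\<close> bounds the norm of \<open>v\<close> (\<open>wnorm_V_bounded\<close>).

  This proves absolute convergence in all directions of sufficiently large argument \<open>l\<close>, whereas the
  branch on the sector may take smaller values. Going down from \<open>l\<close> to an argument \<open>\<theta>\<close>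
  costs a factor \<open>exp ((l - \<theta>) * Im t)\<close>. A smaller radius pays for it if \<open>Im t \<le> C * Re t\<close> on the exponents
  of \<open>v\<close>. This bound (\<open>V_cone\<close>) comes from the other end of the imaginary axis: the coefficients of the
  \<open>E\<^sub>j\<close> at the highest imaginary exponent also form a nonzero polynomial in \<open>\<delta> + T\<close>, without roots
  among the exponents of \<open>v\<close>, so the highest terms of \<open>v\<close> on a vertical line cannot cancel and must come from
  terms to their left. The theorem then follows from the Weierstrass M-test.
\<close>

section \<open>Coefficients and supports\<close>

definition gsupp :: "gpseries \<Rightarrow> complex set"
  where "gsupp f = {t. gcoeff f t \<noteq> 0}"

lemma gcoeff_simps [simp]:
  "gcoeff 0 t = 0"
  "gcoeff (f + g) t = gcoeff f t + gcoeff g t"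
  "gcoeff (- f) t = - gcoeff f t"
  "gcoeff (f - g) t = gcoeff f t - gcoeff g t"
  "gcoeff (gmonom a s) t = (if t = s then a else 0)"
  "gcoeff (gdelta f) t = t * gcoeff f t"
  by (simp_all add: zero_gpseries.rep_eq plus_gpseries.rep_eq uminus_gpseries.rep_eq
      minus_gpseries_def gmonom.rep_eq gdelta.rep_eq del: add_uminus_conv_diff)

lemma gcoeff_sum: "gcoeff (\<Sum>i\<in>I. f i) t = (\<Sum>i\<in>I. gcoeff (f i) t)"
  by (induction I rule: infinite_finite_induct) auto

lemma gcoeff_delta_power: "gcoeff ((gdelta ^^ j) f) t = t ^ j * gcoeff f t"
  by (induction j) auto

lemma gcoeff_gmonom_mult [simp]: "gcoeff (gmonom a s * f) t = a * gcoeff f (t - s)"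
proof -
  have "gcoeff (gmonom a s * f) t = (\<Sum>u\<in>{s}. gcoeff (gmonom a s) u * gcoeff f (t - u))"
    by (rule gcoeff_times_eq) (auto split: if_splits)
  then show ?thesis by simp
qed

lemma gmonom_mult: "gmonom a s * gmonom b t = gmonom (a * b) (s + t)"
  by (rule gpseries_eqI) (auto simp: diff_eq_eq add.commute)

lemma gmonom_one: "gmonom 1 0 = 1"
  by (rule gpseries_eqI) (simp add: one_gpseries.rep_eq)

lemma gmonom_add: "gmonom a s + gmonom b s = gmonom (a + b) s"
  by (rule gpseries_eqI) simp

lemma gmonom_power: "gmonom a s ^ k = gmonom (a ^ k) (of_nat k * s)"
  by (induction k) (simp_all add: gmonom_one gmonom_mult algebra_simps)

lemma of_nat_gmonom: "of_nat k = gmonom (of_nat k) 0"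
proof (induction k)
  case 0
  show ?case by (rule gpseries_eqI) simp
next
  case (Suc k)
  then show ?case by (simp add: gmonom_add flip: gmonom_one)
qed

lemma gsupp_add: "gsupp (f + g) \<subseteq> gsupp f \<union> gsupp g"
  by (auto simp: gsupp_def)

lemma gsupp_gmonom: "gsupp (gmonom a s) \<subseteq> {s}"
  by (auto simp: gsupp_def split: if_splits)

lemma gsupp_mult:
  assumes "t \<in> gsupp (f * g)"
  obtains a b where "a \<in> gsupp f" "b \<in> gsupp g" "t = a + b"
proof -
  obtain a where "gcoeff f a \<noteq> 0" "gcoeff g (t - a) \<noteq> 0"
    using assms gcoeff_times_nonzero unfolding gsupp_def by blast
  then show thesis using that[of a "t - a"] by (simp add: gsupp_def)
qed

lemma gsupp_sum: "gsupp (\<Sum>i\<in>I. f i) \<subseteq> (\<Union>i\<in>I. gsupp (f i))"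
  by (force simp: gsupp_def gcoeff_sum dest: sum.not_neutral_contains_not_neutral)

lemma finite_gsupp_add: "finite (gsupp f) \<Longrightarrow> finite (gsupp g) \<Longrightarrow> finite (gsupp (f + g))"
  by (rule finite_subset[OF gsupp_add]) simp

lemma finite_gsupp_mult:
  assumes "finite (gsupp f)" "finite (gsupp g)" shows "finite (gsupp (f * g))"
proof (rule finite_subset)
  show "gsupp (f * g) \<subseteq> (\<lambda>(a, b). a + b) ` (gsupp f \<times> gsupp g)"
    by (force elim: gsupp_mult)
qed (use assms in simp)

lemma finite_gsupp_gmonom [simp]: "finite (gsupp (gmonom a s))"
  by (rule finite_subset[OF gsupp_gmonom]) simp

lemma finite_gsupp_one [simp]: "finite (gsupp 1)"
  by (simp flip: gmonom_one)

lemma finite_gsupp_power: "finite (gsupp f) \<Longrightarrow> finite (gsupp (f ^ k))"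
  by (induction k) (simp_all add: finite_gsupp_mult)

lemma finite_gsupp_prod: "(\<And>i. i \<in> I \<Longrightarrow> finite (gsupp (f i))) \<Longrightarrow> finite (gsupp (\<Prod>i\<in>I. f i))"
  by (induction I rule: infinite_finite_induct) (simp_all add: finite_gsupp_mult)

lemma finite_gsupp_zero [simp]: "finite (gsupp 0)"
  by (simp add: gsupp_def)

lemma finite_gsupp_sum: "(\<And>i. i \<in> I \<Longrightarrow> finite (gsupp (f i))) \<Longrightarrow> finite (gsupp (\<Sum>i\<in>I. f i))"
  by (induction I rule: infinite_finite_induct) (simp_all add: finite_gsupp_add)

lemma finite_gsupp_eval:
  assumes "\<And>i. finite (gsupp (v i))" shows "finite (gsupp (cpoly_eval F v))"
  unfolding cpoly_eval_def
  by (intro finite_gsupp_sum finite_gsupp_mult finite_gsupp_prod finite_gsupp_power assms) simp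

text \<open>
  The remainder of the expansion below is never needed explicitly. It only matters that it is a
  polynomial in certain series: bounds on the generators then pass to it by induction.
\<close>

inductive_set subalgebra :: "gpseries set \<Rightarrow> gpseries set" for G where
  gen: "g \<in> G \<Longrightarrow> g \<in> subalgebra G"
| const: "gmonom c 0 \<in> subalgebra G"
| add: "f \<in> subalgebra G \<Longrightarrow> g \<in> subalgebra G \<Longrightarrow> f + g \<in> subalgebra G"
| mult: "f \<in> subalgebra G \<Longrightarrow> g \<in> subalgebra G \<Longrightarrow> f * g \<in> subalgebra G"

lemma subalgebra_one: "1 \<in> subalgebra G"
  using subalgebra.const[of 1] by (simp add: gmonom_one)

lemma subalgebra_zero: "0 \<in> subalgebra G"
  using subalgebra.const[of 0] of_nat_gmonom[of 0] by simp

lemma subalgebra_power: "f \<in> subalgebra G \<Longrightarrow> f ^ k \<in> subalgebra G"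
  by (induction k) (simp_all add: subalgebra_one subalgebra.mult)

lemma subalgebra_gsupp:
  assumes "S \<in> subalgebra G" "\<And>g. g \<in> G \<Longrightarrow> gsupp g \<subseteq> {t. 0 \<le> Re t}"
  shows "gsupp S \<subseteq> {t. 0 \<le> Re t}"
  using assms(1)
proof induction
  case (const c)
  then show ?case using gsupp_gmonom[of c 0] by auto
next
  case (add f g)
  then show ?case using gsupp_add[of f g] by blast
next
  case (mult f g)
  then show ?case by (fastforce elim: gsupp_mult)
qed (use assms(2) in auto)

section \<open>First-order expansion of a polynomial\<close>

text \<open>
  \<open>e = e0 + h e1 + O(h\<^sup>2)\<close>, where all coefficients lie in \<open>y\<^sup>-\<^sup>k Q\<close>. The power of \<open>y\<close> allows for
  the finitely many exponents of negative real part; it is kept apart from \<open>h\<close> because it depends on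
  the degree only, so that \<open>h\<close> can be chosen small compared with it.
\<close>

definition first_order ::
    "gpseries set \<Rightarrow> gpseries \<Rightarrow> gpseries \<Rightarrow> nat \<Rightarrow> gpseries \<Rightarrow> gpseries \<Rightarrow> gpseries \<Rightarrow> bool"
  where "first_order Q y h k e e0 e1 \<longleftrightarrow> y ^ k * e0 \<in> Q \<and> y ^ k * e1 \<in> Q \<and>
    (\<exists>s. y ^ k * s \<in> Q \<and> e = e0 + h * e1 + h\<^sup>2 * s)"

context
  fixes Q G y h
  assumes Q: "Q = subalgebra G" and yQ: "y \<in> Q" and hQ: "h \<in> Q"
begin

lemma first_order_weaken:
  assumes "first_order Q y h j e e0 e1" "j \<le> k"
  shows "first_order Q y h k e e0 e1"
proof -
  have "y ^ k * f \<in> Q" if "y ^ j * f \<in> Q" for f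
  proof -
    have "y ^ k * f = y ^ (k - j) * (y ^ j * f)"
      using \<open>j \<le> k\<close> by (metis le_add_diff_inverse2 mult.assoc power_add)
    then show ?thesis using that yQ unfolding Q by (simp add: subalgebra_power subalgebra.mult)
  qed
  then show ?thesis using assms(1) unfolding first_order_def by blast
qed

lemma first_order_mult:
  assumes "first_order Q y h j e e0 e1" "first_order Q y h k f f0 f1"
  shows "first_order Q y h (j + k) (e * f) (e0 * f0) (e1 * f0 + e0 * f1)"
proof -
  obtain s where s: "y ^ j * s \<in> Q" "e = e0 + h * e1 + h\<^sup>2 * s" and e: "y ^ j * e0 \<in> Q" "y ^ j * e1 \<in> Q"
    using assms(1) unfolding first_order_def by blast
  obtain s' where s': "y ^ k * s' \<in> Q" "f = f0 + h * f1 + h\<^sup>2 * s'" and f: "y ^ k * f0 \<in> Q" "y ^ k * f1 \<in> Q"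
    using assms(2) unfolding first_order_def by blast
  have m: "y ^ (j + k) * (a * b) \<in> Q" if "y ^ j * a \<in> Q" "y ^ k * b \<in> Q" for a b
    using subalgebra.mult[OF that[unfolded Q]] unfolding Q by (simp add: power_add algebra_simps)
  have p: "y ^ (j + k) * (a + b) \<in> Q" if "y ^ (j + k) * a \<in> Q" "y ^ (j + k) * b \<in> Q" for a b
    using subalgebra.add[OF that[unfolded Q]] unfolding Q by (simp add: algebra_simps)
  have hm: "y ^ (j + k) * (h * a) \<in> Q" if "y ^ (j + k) * a \<in> Q" for a
    using subalgebra.mult[OF hQ[unfolded Q] that[unfolded Q]] unfolding Q by (simp add: algebra_simps)
  define r where "r = e0 * s' + s * f0 + e1 * f1 + h * (e1 * s' + s * f1) + h * (h * (s * s'))"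
  have "e * f = e0 * f0 + h * (e1 * f0 + e0 * f1) + h\<^sup>2 * r"
    unfolding s(2) s'(2) r_def by (simp add: algebra_simps power2_eq_square)
  moreover have "y ^ (j + k) * r \<in> Q"
    unfolding r_def by (intro p hm m s s' e f)
  ultimately show ?thesis
    unfolding first_order_def using m p e f by blast
qed

lemma first_order_const: "first_order Q y h 0 (gmonom c 0) (gmonom c 0) 0"
  unfolding first_order_def Q using subalgebra.const subalgebra_zero by (auto intro!: exI[of _ 0])

lemma first_order_power:
  assumes "first_order Q y h 1 e e0 e1"
  shows "first_order Q y h k (e ^ k) (e0 ^ k) (of_nat k * e0 ^ (k - 1) * e1)"
proof (induction k)
  case 0
  show ?case using first_order_const[of 1] by (simp add: gmonom_one)
next
  case (Suc k)
  have "e1 * e0 ^ k + e0 * (of_nat k * e0 ^ (k - 1) * e1) = of_nat (Suc k) * e0 ^ (Suc k - 1) * e1"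
    by (cases k) (simp_all add: algebra_simps)
  then show ?case using first_order_mult[OF assms Suc] by simp
qed

lemma first_order_prod:
  assumes "finite I" "\<And>i. i \<in> I \<Longrightarrow> first_order Q y h (k i) (e i) (e0 i) (e1 i)"
  shows "first_order Q y h (\<Sum>i\<in>I. k i) (\<Prod>i\<in>I. e i) (\<Prod>i\<in>I. e0 i)
    (\<Sum>i\<in>I. e1 i * (\<Prod>j\<in>I - {i}. e0 j))"
  using assms
proof (induction I rule: finite_induct)
  case empty
  show ?case using first_order_const[of 1] by (simp add: gmonom_one)
next
  case (insert i I)
  have "(\<Sum>j\<in>insert i I. e1 j * (\<Prod>l\<in>insert i I - {j}. e0 l))
      = e1 i * (\<Prod>l\<in>I. e0 l) + (\<Sum>j\<in>I. e1 j * (\<Prod>l\<in>insert i I - {j}. e0 l))"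
    using insert by simp
  also have "(\<Sum>j\<in>I. e1 j * (\<Prod>l\<in>insert i I - {j}. e0 l))
      = e0 i * (\<Sum>j\<in>I. e1 j * (\<Prod>l\<in>I - {j}. e0 l))"
    unfolding sum_distrib_left
  proof (rule sum.cong)
    fix j assume "j \<in> I"
    then have "insert i I - {j} = insert i (I - {j})" using insert by auto
    then show "e1 j * (\<Prod>l\<in>insert i I - {j}. e0 l) = e0 i * (e1 j * (\<Prod>l\<in>I - {j}. e0 l))"
      using insert by (simp add: algebra_simps)
  qed simp
  finally show ?case
    using first_order_mult[OF insert.prems[of i] insert.IH] insert by simp
qed

lemma first_order_sum:
  assumes "\<And>i. i \<in> I \<Longrightarrow> first_order Q y h k (e i) (e0 i) (e1 i)"
  shows "first_order Q y h k (\<Sum>i\<in>I. e i) (\<Sum>i\<in>I. e0 i) (\<Sum>i\<in>I. e1 i)"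
  using assms
proof (induction I rule: infinite_finite_induct)
  case (insert i I)
  obtain s where s: "y ^ k * s \<in> Q" "(\<Sum>i\<in>I. e i) = (\<Sum>i\<in>I. e0 i) + h * (\<Sum>i\<in>I. e1 i) + h\<^sup>2 * s"
      and e: "y ^ k * (\<Sum>i\<in>I. e0 i) \<in> Q" "y ^ k * (\<Sum>i\<in>I. e1 i) \<in> Q"
    using insert unfolding first_order_def by auto
  obtain s' where s': "y ^ k * s' \<in> Q" "e i = e0 i + h * e1 i + h\<^sup>2 * s'"
      and e': "y ^ k * e0 i \<in> Q" "y ^ k * e1 i \<in> Q"
    using insert.prems[of i] unfolding first_order_def by auto
  have p: "y ^ k * (a + b) \<in> Q" if "y ^ k * a \<in> Q" "y ^ k * b \<in> Q" for a b
    using subalgebra.add[OF that[unfolded Q]] unfolding Q by (simp add: algebra_simps)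
  have "e i + (\<Sum>i\<in>I. e i) = (e0 i + (\<Sum>i\<in>I. e0 i)) + h * (e1 i + (\<Sum>i\<in>I. e1 i)) + h\<^sup>2 * (s' + s)"
    unfolding s(2) s'(2) by (simp add: algebra_simps)
  then show ?case
    unfolding first_order_def sum.insert[OF insert(1,2)]
    using p[OF e'(1) e(1)] p[OF e'(2) e(2)] p[OF s'(1) s(1)] by blast
qed (auto simp: first_order_def Q subalgebra_zero intro!: exI[of _ 0])

end

definition monom_eval :: "(nat \<Rightarrow>\<^sub>0 nat) \<Rightarrow> (nat \<Rightarrow> gpseries) \<Rightarrow> gpseries"
  where "monom_eval m v = (\<Prod>i\<in>Poly_Mapping.keys m. v i ^ Poly_Mapping.lookup m i)"

text \<open>
  Monomials and polynomials may be evaluated over any larger finite index set, since a variable that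
  does not occur has exponent \<open>0\<close> and a monomial that does not occur has coefficient \<open>0\<close>.
\<close>

lemma monom_eval_superset:
  assumes "finite A" "Poly_Mapping.keys m \<subseteq> A"
  shows "monom_eval m v = (\<Prod>i\<in>A. v i ^ Poly_Mapping.lookup m i)"
  unfolding monom_eval_def using assms
  by (intro prod.mono_neutral_left) (auto simp: in_keys_iff)

lemma cpoly_eval_superset:
  assumes "finite A" "Poly_Mapping.keys F \<subseteq> A"
  shows "cpoly_eval F v = (\<Sum>m\<in>A. gmonom (Poly_Mapping.lookup F m) 0 * monom_eval m v)"
  unfolding cpoly_eval_def monom_eval_def[symmetric] using assms of_nat_gmonom[of 0]
  by (intro sum.mono_neutral_left) (auto simp: in_keys_iff)

lemma cpoly_eval_add: "cpoly_eval (F + G) v = cpoly_eval F v + cpoly_eval G v"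
proof -
  let ?A = "Poly_Mapping.keys F \<union> Poly_Mapping.keys G"
  have "Poly_Mapping.keys (F + G) \<subseteq> ?A" by (rule Poly_Mapping.keys_add)
  then show ?thesis
    by (simp add: cpoly_eval_superset[of ?A] lookup_add sum.distrib algebra_simps
        flip: gmonom_add)
qed

lemma cpoly_eval_sum: "cpoly_eval (\<Sum>i\<in>I. F i) v = (\<Sum>i\<in>I. cpoly_eval (F i) v)"
  by (induction I rule: infinite_finite_induct) (simp_all add: cpoly_eval_add, simp_all add: cpoly_eval_def)

lemma cpoly_eval_single: "cpoly_eval (Poly_Mapping.single m a) v = gmonom a 0 * monom_eval m v"
  by (subst cpoly_eval_superset[of "{m}"]) auto

lemma cpoly_eval_pderiv:
  "cpoly_eval (cpoly_pderiv i F) v = (\<Sum>m\<in>Poly_Mapping.keys F. gmonom (Poly_Mapping.lookup F m) 0 *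
    (of_nat (Poly_Mapping.lookup m i) * v i ^ (Poly_Mapping.lookup m i - 1) *
      (\<Prod>j\<in>Poly_Mapping.keys m - {i}. v j ^ Poly_Mapping.lookup m j)))"
proof -
  have "gmonom (of_nat (Poly_Mapping.lookup m i) * Poly_Mapping.lookup F m) 0 *
      monom_eval (m - Poly_Mapping.single i 1) v = gmonom (Poly_Mapping.lookup F m) 0 *
    (of_nat (Poly_Mapping.lookup m i) * v i ^ (Poly_Mapping.lookup m i - 1) *
      (\<Prod>j\<in>Poly_Mapping.keys m - {i}. v j ^ Poly_Mapping.lookup m j))" for m
  proof (cases "i \<in> Poly_Mapping.keys m")
    case True
    let ?m = "m - Poly_Mapping.single i 1"
    have l: "Poly_Mapping.lookup ?m j = Poly_Mapping.lookup m j - (if j = i then 1 else 0)" for j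
      by (simp add: lookup_minus lookup_single when_def)
    have "Poly_Mapping.keys ?m \<subseteq> Poly_Mapping.keys m"
      by (auto simp: in_keys_iff l simp del: One_nat_def)
    then have "monom_eval ?m v = (\<Prod>j\<in>Poly_Mapping.keys m. v j ^ Poly_Mapping.lookup ?m j)"
      by (rule monom_eval_superset[rotated]) simp
    also have "\<dots> = v i ^ (Poly_Mapping.lookup m i - 1) *
        (\<Prod>j\<in>Poly_Mapping.keys m - {i}. v j ^ Poly_Mapping.lookup m j)"
      by (subst prod.remove[OF _ True]) (auto simp: l[unfolded One_nat_def] intro!: prod.cong arg_cong2[of _ _ _ _ "(*)"])
    finally have "monom_eval ?m v = v i ^ (Poly_Mapping.lookup m i - 1) *
        (\<Prod>j\<in>Poly_Mapping.keys m - {i}. v j ^ Poly_Mapping.lookup m j)" .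
    moreover have "gmonom (of_nat (Poly_Mapping.lookup m i) * Poly_Mapping.lookup F m) 0
        = gmonom (Poly_Mapping.lookup F m) 0 * of_nat (Poly_Mapping.lookup m i)"
      unfolding of_nat_gmonom[of "Poly_Mapping.lookup m i"] gmonom_mult by (simp add: mult.commute)
    ultimately show ?thesis by (simp only: mult.assoc)
  next
    case False
    then show ?thesis using of_nat_gmonom[of 0] by (simp add: in_keys_iff)
  qed
  then show ?thesis
    unfolding cpoly_pderiv_def cpoly_eval_sum cpoly_eval_single by simp
qed

text \<open>
  A crude bound for the total degree. It depends on \<open>F\<close> alone and not on the point of expansion, which
  is why the truncation level can be chosen after it.
\<close>

definition cdeg :: "cpoly \<Rightarrow> nat"
  where "cdeg F = (\<Sum>m\<in>Poly_Mapping.keys F. \<Sum>i\<in>Poly_Mapping.keys m. Poly_Mapping.lookup m i)"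

text \<open>
  Taylor's formula: each monomial is a product of powers of variables, so the product rule gives its
  linear part, and summing over the monomials gives the partial derivatives.
\<close>

lemma first_order_cpoly_eval:
  assumes Q: "Q = subalgebra G" and yQ: "y \<in> Q" and hQ: "h \<in> Q"
    and I: "finite I" "cpoly_vars F \<subseteq> I"
    and a: "\<And>i. i \<in> I \<Longrightarrow> y * a i \<in> Q" and w: "\<And>i. i \<in> I \<Longrightarrow> w i \<in> Q"
  shows "first_order Q y h (cdeg F) (cpoly_eval F (\<lambda>i. a i + h * w i)) (cpoly_eval F a)
    (\<Sum>i\<in>I. cpoly_eval (cpoly_pderiv i F) a * w i)"
proof -
  note ctx = Q yQ hQ
  let ?L = Poly_Mapping.lookup and ?K = Poly_Mapping.keys
  define D where "D m i = of_nat (?L m i) * a i ^ (?L m i - 1) * (\<Prod>j\<in>?K m - {i}. a j ^ ?L m j)" for m i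
  have var: "first_order Q y h 1 (a i + h * w i) (a i) (w i)" if "i \<in> I" for i
    unfolding first_order_def using a[OF that] w[OF that] yQ unfolding Q
    by (auto intro!: subalgebra.mult exI[of _ 0] simp: subalgebra_zero)
  have mon: "first_order Q y h (cdeg F) (gmonom (?L F m) 0 * monom_eval m (\<lambda>i. a i + h * w i))
      (gmonom (?L F m) 0 * monom_eval m a) (gmonom (?L F m) 0 * (\<Sum>i\<in>I. D m i * w i))"
    if m: "m \<in> ?K F" for m
  proof -
    have mI: "?K m \<subseteq> I" using m I(2) unfolding cpoly_vars_def by blast
    have "first_order Q y h (\<Sum>i\<in>?K m. ?L m i) (monom_eval m (\<lambda>i. a i + h * w i)) (monom_eval m a)
      (\<Sum>i\<in>?K m. (of_nat (?L m i) * a i ^ (?L m i - 1) * w i) * (\<Prod>j\<in>?K m - {i}. a j ^ ?L m j))"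
      unfolding monom_eval_def
      by (intro first_order_prod[OF ctx] first_order_power[OF ctx] var) (use mI in auto)
    also have "(\<Sum>i\<in>?K m. (of_nat (?L m i) * a i ^ (?L m i - 1) * w i) * (\<Prod>j\<in>?K m - {i}. a j ^ ?L m j))
        = (\<Sum>i\<in>?K m. D m i * w i)"
      by (intro sum.cong) (simp_all add: D_def algebra_simps)
    also have "\<dots> = (\<Sum>i\<in>I. D m i * w i)"
      using I(1) mI by (intro sum.mono_neutral_left) (auto simp: D_def in_keys_iff)
    finally have "first_order Q y h (\<Sum>i\<in>?K m. ?L m i) (monom_eval m (\<lambda>i. a i + h * w i))
      (monom_eval m a) (\<Sum>i\<in>I. D m i * w i)" .
    from first_order_mult[OF ctx first_order_const[OF ctx] this]
    have "first_order Q y h (\<Sum>i\<in>?K m. ?L m i) (gmonom (?L F m) 0 * monom_eval m (\<lambda>i. a i + h * w i))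
      (gmonom (?L F m) 0 * monom_eval m a) (gmonom (?L F m) 0 * (\<Sum>i\<in>I. D m i * w i))"
      by simp
    moreover have "(\<Sum>i\<in>?K m. ?L m i) \<le> cdeg F"
      unfolding cdeg_def using m by (intro member_le_sum) auto
    ultimately show ?thesis by (rule first_order_weaken[OF ctx])
  qed
  have "(\<Sum>m\<in>?K F. gmonom (?L F m) 0 * (\<Sum>i\<in>I. D m i * w i))
      = (\<Sum>i\<in>I. cpoly_eval (cpoly_pderiv i F) a * w i)"
    unfolding cpoly_eval_pderiv D_def[symmetric] sum_distrib_left sum_distrib_right
    by (subst sum.swap) (simp add: mult.assoc)
  then show ?thesis
    using first_order_sum[OF ctx mon, of "?K F" "\<lambda>m. m"]
    by (simp add: cpoly_eval_superset[of "?K F"])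
qed

section \<open>Weighted norms\<close>

text \<open>
  Since \<open>exp (z * t)\<close> is the value of \<open>x\<^sup>t\<close> at a point with \<open>log x = z\<close>, this is the sum of the absolute
  values of the terms at that point, cut off at real part \<open>R\<close> so that it is finite for a series
  whose convergence is not yet known.
\<close>

definition wnorm :: "complex \<Rightarrow> real \<Rightarrow> gpseries \<Rightarrow> real"
  where "wnorm z R f = (\<Sum>t | gcoeff f t \<noteq> 0 \<and> Re t \<le> R. norm (gcoeff f t * exp (z * t)))"

lemma wnorm_superset:
  assumes "finite A" "{t. gcoeff f t \<noteq> 0 \<and> Re t \<le> R} \<subseteq> A" "A \<subseteq> {t. Re t \<le> R}"
  shows "wnorm z R f = (\<Sum>t\<in>A. norm (gcoeff f t * exp (z * t)))"
  unfolding wnorm_def using assms by (intro sum.mono_neutral_left) auto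

lemma wnorm_nonneg: "0 \<le> wnorm z R f"
  unfolding wnorm_def by (intro sum_nonneg) auto

lemma wnorm_le_sum:
  assumes "finite A" "{t. gcoeff f t \<noteq> 0 \<and> Re t \<le> R} \<subseteq> A"
  shows "wnorm z R f \<le> (\<Sum>t\<in>A. norm (gcoeff f t * exp (z * t)))"
  unfolding wnorm_def using assms by (intro sum_mono2) auto

lemma sum_le_wnorm:
  assumes "finite A" "A \<subseteq> {t. Re t \<le> R}"
  shows "(\<Sum>t\<in>A. norm (gcoeff f t * exp (z * t))) \<le> wnorm z R f"
proof -
  let ?B = "A \<union> {t. gcoeff f t \<noteq> 0 \<and> Re t \<le> R}"
  have "wnorm z R f = (\<Sum>t\<in>?B. norm (gcoeff f t * exp (z * t)))"
    using assms finite_gcoeff[of f R] by (intro wnorm_superset) auto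
  moreover have "(\<Sum>t\<in>A. norm (gcoeff f t * exp (z * t))) \<le> (\<Sum>t\<in>?B. norm (gcoeff f t * exp (z * t)))"
    using assms finite_gcoeff[of f R] by (intro sum_mono2) auto
  ultimately show ?thesis by simp
qed

lemma wnorm_mono: "R \<le> R' \<Longrightarrow> wnorm z R f \<le> wnorm z R' f"
  unfolding wnorm_def[of z R] by (intro sum_le_wnorm finite_gcoeff) auto

lemma wnorm_uminus [simp]: "wnorm z R (- f) = wnorm z R f"
  by (simp add: wnorm_def)

lemma wnorm_zero [simp]: "wnorm z R 0 = 0"
  by (simp add: wnorm_def)

lemma wnorm_add: "wnorm z R (f + g) \<le> wnorm z R f + wnorm z R g"
proof -
  let ?A = "{t. gcoeff f t \<noteq> 0 \<and> Re t \<le> R} \<union> {t. gcoeff g t \<noteq> 0 \<and> Re t \<le> R}"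
  have A: "finite ?A" "?A \<subseteq> {t. Re t \<le> R}" using finite_gcoeff by auto
  have "wnorm z R (f + g) \<le> (\<Sum>t\<in>?A. norm (gcoeff (f + g) t * exp (z * t)))"
    by (rule wnorm_le_sum[OF A(1)]) auto
  also have "\<dots> \<le> (\<Sum>t\<in>?A. norm (gcoeff f t * exp (z * t)) + norm (gcoeff g t * exp (z * t)))"
    by (intro sum_mono) (simp add: distrib_right norm_triangle_ineq)
  also have "\<dots> \<le> wnorm z R f + wnorm z R g"
    unfolding sum.distrib by (intro add_mono sum_le_wnorm A)
  finally show ?thesis .
qed

lemma wnorm_sum: "wnorm z R (\<Sum>i\<in>I. f i) \<le> (\<Sum>i\<in>I. wnorm z R (f i))"
proof (induction I rule: infinite_finite_induct)
  case (insert i I)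
  then show ?case using wnorm_add[of z R "f i" "\<Sum>i\<in>I. f i"] by simp
qed auto

lemma wnorm_gmonom: "wnorm z R (gmonom c 0) \<le> norm c"
  by (rule order_trans[OF wnorm_le_sum[of "{0}"]]) auto

lemma wnorm_gmonom_mult: "wnorm z R (gmonom 1 s * f) = norm (exp (z * s)) * wnorm z (R - Re s) f"
proof -
  have "norm (exp (z * s)) * norm (a * exp (z * (t - s))) = norm (a * exp (z * t))" for a t
  proof -
    have "exp (z * t) = exp (z * s) * exp (z * (t - s))"
      by (simp add: right_diff_distrib flip: exp_add)
    then show ?thesis by (simp add: norm_mult)
  qed
  then show ?thesis
    unfolding wnorm_def sum_distrib_left
    by (intro sum.reindex_bij_witness[of _ "\<lambda>t. t + s" "\<lambda>t. t - s"])
       (simp_all del: norm_exp_eq_Re )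
qed

text \<open>
  If no exponent has negative real part, a term of the product with real part at most \<open>R\<close> only comes
  from factors with real part at most \<open>R\<close>. This is why the cut-off does not destroy
  submultiplicativity.
\<close>

lemma wnorm_mult:
  assumes f: "gsupp f \<subseteq> {t. 0 \<le> Re t}" and g: "gsupp g \<subseteq> {t. 0 \<le> Re t}"
  shows "wnorm z R (f * g) \<le> wnorm z R f * wnorm z R g"
proof -
  define U where "U = {t. gcoeff f t \<noteq> 0 \<and> Re t \<le> R}"
  define V where "V = {t. gcoeff g t \<noteq> 0 \<and> Re t \<le> R}"
  define W where "W = {t. gcoeff (f * g) t \<noteq> 0 \<and> Re t \<le> R}"
  have fin: "finite U" "finite V" "finite W"
    unfolding U_def V_def W_def by (rule finite_gcoeff)+
  let ?F = "\<lambda>u. norm (gcoeff f u * exp (z * u))" and ?G = "\<lambda>u. norm (gcoeff g u * exp (z * u))"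
  have "norm (gcoeff (f * g) t * exp (z * t)) \<le> (\<Sum>u\<in>U. ?F u * ?G (t - u))" if "t \<in> W" for t
  proof -
    have "Re t \<le> R" using that by (simp add: W_def)
    have "u \<in> U" if "gcoeff f u \<noteq> 0" "gcoeff g (t - u) \<noteq> 0" for u
    proof -
      have "0 \<le> Re (t - u)" using g that(2) by (auto simp: gsupp_def)
      then show ?thesis using that(1) \<open>Re t \<le> R\<close> by (simp add: U_def)
    qed
    then have eq: "gcoeff (f * g) t = (\<Sum>u\<in>U. gcoeff f u * gcoeff g (t - u))"
      by (intro gcoeff_times_eq fin) auto
    have "gcoeff (f * g) t * exp (z * t)
        = (\<Sum>u\<in>U. (gcoeff f u * exp (z * u)) * (gcoeff g (t - u) * exp (z * (t - u))))"
      unfolding eq sum_distrib_right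
    proof (intro sum.cong refl)
      fix u
      have "exp (z * t) = exp (z * u) * exp (z * (t - u))"
        by (simp add: right_diff_distrib flip: exp_add)
      then show "gcoeff f u * gcoeff g (t - u) * exp (z * t)
          = (gcoeff f u * exp (z * u)) * (gcoeff g (t - u) * exp (z * (t - u)))"
        by simp
    qed
    also have "norm \<dots> \<le> (\<Sum>u\<in>U. ?F u * ?G (t - u))"
      by (rule sum_norm_le) (simp add: norm_mult)
    finally show ?thesis .
  qed
  then have "wnorm z R (f * g) \<le> (\<Sum>t\<in>W. \<Sum>u\<in>U. ?F u * ?G (t - u))"
    unfolding wnorm_def W_def by (intro sum_mono) auto
  also have "\<dots> = (\<Sum>u\<in>U. ?F u * (\<Sum>t\<in>W. ?G (t - u)))"
    by (subst sum.swap) (simp add: sum_distrib_left)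
  also have "\<dots> \<le> (\<Sum>u\<in>U. ?F u * wnorm z R g)"
  proof (intro sum_mono mult_left_mono)
    fix u assume "u \<in> U"
    then have "0 \<le> Re u" using f by (auto simp: U_def gsupp_def)
    have "(\<Sum>t\<in>W. ?G (t - u)) = (\<Sum>v\<in>(\<lambda>t. t - u) ` W. ?G v)"
      by (simp add: sum.reindex inj_on_def)
    also have "\<dots> \<le> wnorm z R g"
      using fin \<open>0 \<le> Re u\<close> by (intro sum_le_wnorm) (auto simp: W_def)
    finally show "(\<Sum>t\<in>W. ?G (t - u)) \<le> wnorm z R g" .
  qed simp
  also have "\<dots> = wnorm z R f * wnorm z R g"
    unfolding wnorm_def[of z R f] U_def by (simp add: sum_distrib_right)
  finally show ?thesis .
qed

text \<open>
  The bound \<open>C\<close> is uniform in the point \<open>z\<close> and in the cut-off \<open>R\<close>; the induction on \<open>R\<close> that proves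
  convergence rests on this.
\<close>

lemma subalgebra_wnorm_bounded:
  assumes "S \<in> subalgebra G" and G: "\<And>g. g \<in> G \<Longrightarrow> gsupp g \<subseteq> {t. 0 \<le> Re t}"
  shows "\<exists>C. \<forall>z R. (\<forall>g\<in>G. wnorm z R g \<le> M) \<longrightarrow> wnorm z R S \<le> C"
  using assms(1)
proof induction
  case (gen g)
  then show ?case by blast
next
  case (const c)
  then show ?case using wnorm_gmonom by blast
next
  case (add f g)
  then obtain C D where "\<forall>z R. (\<forall>g\<in>G. wnorm z R g \<le> M) \<longrightarrow> wnorm z R f \<le> C"
    "\<forall>z R. (\<forall>g\<in>G. wnorm z R g \<le> M) \<longrightarrow> wnorm z R g \<le> D" by blast
  then have "\<forall>z R. (\<forall>g\<in>G. wnorm z R g \<le> M) \<longrightarrow> wnorm z R (f + g) \<le> C + D"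
    by (meson add_mono order_trans wnorm_add)
  then show ?case ..
next
  case (mult f g)
  then obtain C D where *: "\<forall>z R. (\<forall>g\<in>G. wnorm z R g \<le> M) \<longrightarrow> wnorm z R f \<le> C"
    "\<forall>z R. (\<forall>g\<in>G. wnorm z R g \<le> M) \<longrightarrow> wnorm z R g \<le> D" by blast
  have "wnorm z R (f * g) \<le> C * D" if "\<forall>g\<in>G. wnorm z R g \<le> M" for z R
  proof -
    have "wnorm z R (f * g) \<le> wnorm z R f * wnorm z R g"
      by (intro wnorm_mult subalgebra_gsupp[OF mult.hyps(1) G] subalgebra_gsupp[OF mult.hyps(2) G])
    also have "\<dots> \<le> C * D"
    proof -
      have "wnorm z R f \<le> C" "wnorm z R g \<le> D" using * that by blast+
      then show ?thesis by (intro mult_mono order_trans[OF wnorm_nonneg] wnorm_nonneg)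
    qed
    finally show ?thesis .
  qed
  then show ?case by blast
qed

text \<open>
  Exponents in the cone \<open>Im t \<le> C * Re t\<close> are closed under addition. The restriction to \<open>Re t < R\<close>
  is compatible with products since all real parts are nonnegative.
\<close>

lemma subalgebra_cone:
  assumes "S \<in> subalgebra G" and G: "\<And>g. g \<in> G \<Longrightarrow> gsupp g \<subseteq> {t. 0 \<le> Re t}"
    and cone: "\<And>g t. g \<in> G \<Longrightarrow> t \<in> gsupp g \<Longrightarrow> Re t < R \<Longrightarrow> Im t \<le> C * Re t"
    and "t \<in> gsupp S" "Re t < R"
  shows "Im t \<le> C * Re t"
  using assms(1,4,5)
proof (induction arbitrary: t)
  case (const c)
  then show ?case using gsupp_gmonom[of c 0] by auto
next
  case (add f g)
  then show ?case using gsupp_add[of f g] by blast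
next
  case (mult f g)
  obtain a b where ab: "a \<in> gsupp f" "b \<in> gsupp g" "t = a + b"
    using mult.prems(1) by (rule gsupp_mult)
  have "0 \<le> Re a" "0 \<le> Re b"
    using subalgebra_gsupp[OF mult.hyps(1) G] subalgebra_gsupp[OF mult.hyps(2) G] ab by auto
  then have "Im a \<le> C * Re a" "Im b \<le> C * Re b"
    using mult.IH ab mult.prems(2) by auto
  then show ?case using ab(3) by (simp add: algebra_simps)
qed (use cone in auto)

lemma eventually_weight_small:
  assumes "0 < Re t" "0 < e"
  shows "\<forall>\<^sub>F \<mu> in at_bot. norm (a * exp (Complex \<mu> l * t)) < e"
proof -
  have "filterlim (\<lambda>\<mu>::real. Re t * \<mu>) at_bot at_bot"
    using assms(1)
    by (intro filterlim_tendsto_pos_mult_at_bot[OF tendsto_const _ filterlim_ident])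
  then have "((\<lambda>\<mu>. norm a * exp (- l * Im t) * exp (Re t * \<mu>)) \<longlongrightarrow> norm a * exp (- l * Im t) * 0) at_bot"
    by (intro tendsto_mult tendsto_const filterlim_compose[OF exp_at_bot])
  then have "\<forall>\<^sub>F \<mu> in at_bot. norm a * exp (- l * Im t) * exp (Re t * \<mu>) < e"
    using assms(2) by (intro order_tendstoD) auto
  moreover have "norm (a * exp (Complex \<mu> l * t)) = norm a * exp (- l * Im t) * exp (Re t * \<mu>)" for \<mu>
    by (simp add: norm_mult mult.assoc mult.commute[of \<mu>] flip: exp_add)
  ultimately show ?thesis by simp
qed

text \<open>
  A term whose exponent is \<open>\<succ> 0\<close> can be made small, but the order of the two limits matters: an
  exponent on the positive imaginary axis is insensitive to \<open>\<mu>\<close> and needs a large argument \<open>l\<close>.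
\<close>

lemma eventually_eventually_weight_small:
  assumes "exp_less 0 t" "0 < e"
  shows "\<forall>\<^sub>F l in at_top. \<forall>\<^sub>F \<mu> in at_bot. norm (a * exp (Complex \<mu> l * t)) < e"
proof (cases "0 < Re t")
  case True
  then show ?thesis using assms(2) by (intro always_eventually allI eventually_weight_small)
next
  case False
  then have t: "Re t = 0" "0 < Im t" using assms(1) by (auto simp: exp_less_def)
  have "filterlim (\<lambda>l::real. - Im t * l) at_bot at_top"
    using t by (intro filterlim_tendsto_neg_mult_at_bot[OF tendsto_const _ filterlim_ident]) auto
  then have "((\<lambda>l. norm a * exp (- Im t * l)) \<longlongrightarrow> norm a * 0) at_top"
    by (intro tendsto_mult tendsto_const filterlim_compose[OF exp_at_bot])
  then have "\<forall>\<^sub>F l in at_top. norm a * exp (- Im t * l) < e"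
    using assms(2) by (intro order_tendstoD) auto
  then show ?thesis
    by eventually_elim (use t in \<open>simp add: norm_mult mult.commute\<close>)
qed

lemma wnorm_small:
  assumes fin: "finite (gsupp f)" and pos: "\<And>t. t \<in> gsupp f \<Longrightarrow> exp_less 0 t" and "0 < e"
  shows "\<forall>\<^sub>F l in at_top. \<forall>\<^sub>F \<mu> in at_bot. \<forall>R. wnorm (Complex \<mu> l) R f \<le> e"
proof -
  define d where "d = e / (card (gsupp f) + 1)"
  have "0 < d" using \<open>0 < e\<close> by (simp add: d_def)
  have "\<forall>\<^sub>F l in at_top. \<forall>\<^sub>F \<mu> in at_bot. \<forall>t\<in>gsupp f. norm (gcoeff f t * exp (Complex \<mu> l * t)) < d"
    unfolding eventually_ball_finite_distrib[OF fin]
    using eventually_eventually_weight_small[OF pos \<open>0 < d\<close>] by blast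
  moreover have "wnorm (Complex \<mu> l) R f \<le> e"
    if *: "\<forall>t\<in>gsupp f. norm (gcoeff f t * exp (Complex \<mu> l * t)) < d" for \<mu> l R
  proof -
    have "wnorm (Complex \<mu> l) R f \<le> (\<Sum>t\<in>gsupp f. norm (gcoeff f t * exp (Complex \<mu> l * t)))"
      by (rule wnorm_le_sum[OF fin]) (auto simp: gsupp_def)
    also have "\<dots> \<le> (\<Sum>t\<in>gsupp f. d)" using * by (intro sum_mono) (simp add: less_imp_le)
    also have "\<dots> \<le> e" using \<open>0 < e\<close> by (simp add: d_def field_simps)
    finally show ?thesis .
  qed
  ultimately show ?thesis by (auto elim!: eventually_mono)
qed

lemma wnorm_bounded:
  assumes "finite (gsupp f)" "gsupp f \<subseteq> {t. 0 \<le> Re t}"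
  shows "\<exists>M. \<forall>\<mu>\<le>0. \<forall>R. wnorm (Complex \<mu> l) R f \<le> M"
proof (intro exI allI impI)
  fix \<mu> R :: real assume "\<mu> \<le> 0"
  have "wnorm (Complex \<mu> l) R f \<le> (\<Sum>t\<in>gsupp f. norm (gcoeff f t * exp (Complex \<mu> l * t)))"
    by (rule wnorm_le_sum[OF assms(1)]) (auto simp: gsupp_def)
  also have "\<dots> \<le> (\<Sum>t\<in>gsupp f. norm (gcoeff f t) * exp (- l * Im t))"
  proof (intro sum_mono)
    fix t assume "t \<in> gsupp f"
    then have "0 \<le> Re t" using assms(2) by auto
    then have "\<mu> * Re t \<le> 0" using \<open>\<mu> \<le> 0\<close> by (simp add: mult_nonpos_nonneg)
    then show "norm (gcoeff f t * exp (Complex \<mu> l * t)) \<le> norm (gcoeff f t) * exp (- l * Im t)"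
      by (simp add: norm_mult mult_left_mono)
  qed
  finally show "wnorm (Complex \<mu> l) R f \<le> (\<Sum>t\<in>gsupp f. norm (gcoeff f t) * exp (- l * Im t))" .
qed

section \<open>The reduced equation\<close>

text \<open>
  The equation for the tail \<open>x\<^sup>T V 0\<close> of the series, with \<open>V j\<close> standing for \<open>(\<delta> + T)\<^sup>j V 0\<close>, so that
  \<open>x\<^sup>T V j\<close> is the \<open>j\<close>-th iterate of \<open>\<delta>\<close> on the tail. The linear part has finite
  coefficients \<open>E j\<close> with exponents \<open>\<succeq> 0\<close>. Two polynomials are read off from it: the constant
  terms of the \<open>E j\<close> give one that dominates all \<open>(\<delta> + T)\<^sup>j\<close> (assumption \<open>B\<close>), and their
  coefficients at \<open>\<i> b\<close>, the highest exponent on the imaginary axis, give one that has no root on the exponents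
  of the tail (assumption \<open>top\<close>). The nonlinear part \<open>S\<close> is preceded by a factor that raises real parts
  by at least \<open>1\<close>.
\<close>

locale reduced_equation =
  fixes n :: nat and T :: complex and V E :: "nat \<Rightarrow> gpseries" and f S :: gpseries
    and G :: "gpseries set" and \<kappa> :: complex and B b :: real
  assumes V: "\<And>j t. gcoeff (V j) t = (t + T) ^ j * gcoeff (V 0) t"
    and V_pos: "\<And>t. t \<in> gsupp (V 0) \<Longrightarrow> 0 < Re t"
    and G: "finite G" "\<And>g. g \<in> G \<Longrightarrow> finite (gsupp g)" "\<And>g t. g \<in> G \<Longrightarrow> t \<in> gsupp g \<Longrightarrow> 0 < Re t"
    and E: "\<And>j. j \<le> n \<Longrightarrow> finite (gsupp (E j))" "\<And>j t. j \<le> n \<Longrightarrow> t \<in> gsupp (E j) \<Longrightarrow> 0 \<preceq> t"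
    and f: "finite (gsupp f)"
    and S: "S \<in> subalgebra (G \<union> V ` {..n})"
    and \<kappa>: "1 \<le> Re \<kappa>"
    and eq: "f + (\<Sum>j\<le>n. E j * V j) + gmonom 1 \<kappa> * S = 0"
    and B: "0 < B" "\<And>t j. 0 < Re t \<Longrightarrow> j \<le> n \<Longrightarrow>
      norm (t + T) ^ j \<le> B * norm (\<Sum>i\<le>n. gcoeff (E i) 0 * (t + T) ^ i)"
    and b: "0 \<le> b" "\<And>j t. j \<le> n \<Longrightarrow> t \<in> gsupp (E j) \<Longrightarrow> Re t = 0 \<Longrightarrow> Im t \<le> b"
    and top: "\<And>t. 0 < Re t \<Longrightarrow> (\<Sum>i\<le>n. gcoeff (E i) (Complex 0 b) * (t + T) ^ i) \<noteq> 0"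
begin

lemma gsupp_V: "t \<in> gsupp (V j) \<Longrightarrow> t \<in> gsupp (V 0)"
  using V[of j t] by (auto simp: gsupp_def)

lemma V_j_pos: "t \<in> gsupp (V j) \<Longrightarrow> 0 < Re t"
  using V_pos gsupp_V by blast

lemma generators_nonneg: "g \<in> G \<union> V ` {..n} \<Longrightarrow> gsupp g \<subseteq> {t. 0 \<le> Re t}"
  using G(3) V_j_pos by (force simp: less_imp_le)

lemma S_nonneg: "gsupp S \<subseteq> {t. 0 \<le> Re t}"
  using S generators_nonneg by (rule subalgebra_gsupp)

lemma E_nonneg: "j \<le> n \<Longrightarrow> t \<in> gsupp (E j) \<Longrightarrow> 0 \<le> Re t"
  using E(2)[of j t] by (auto simp: exp_le_def exp_less_def)

lemma f_eq: "f = - ((\<Sum>j\<le>n. E j * V j) + gmonom 1 \<kappa> * S)"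
  using eq by (simp only: eq_neg_iff_add_eq_0 add.assoc)

lemma f_pos:
  assumes "t \<in> gsupp f" shows "0 < Re t"
proof -
  have "t \<in> gsupp (\<Sum>j\<le>n. E j * V j) \<or> t \<in> gsupp (gmonom 1 \<kappa> * S)"
    using assms unfolding f_eq by (auto simp: gsupp_def)
  then show ?thesis
  proof
    assume "t \<in> gsupp (\<Sum>j\<le>n. E j * V j)"
    then obtain j where "j \<le> n" "t \<in> gsupp (E j * V j)" using gsupp_sum by fastforce
    then show ?thesis
      using E_nonneg V_j_pos by (fastforce elim!: gsupp_mult intro: add_nonneg_pos)
  next
    assume "t \<in> gsupp (gmonom 1 \<kappa> * S)"
    then have "t - \<kappa> \<in> gsupp S" by (simp add: gsupp_def)
    then show ?thesis using S_nonneg \<kappa> by force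
  qed
qed

text \<open>
  Solving for the constant terms of the linear part bounds the norms of all \<open>V j\<close> up to the cut-off
  \<open>R\<close> by those of \<open>f\<close>, of the remaining linear part and of \<open>x\<^sup>\<kappa> S\<close>. The first is small, the second is
  absorbed by the left-hand side, and the third involves the \<open>V j\<close> only up to \<open>R - 1\<close>.
  Hence the bound \<open>1\<close> passes from one integer cut-off to the next.
\<close>

theorem wnorm_V_bounded: "\<forall>\<^sub>F l in at_top. \<exists>\<mu>. \<forall>R. wnorm (Complex \<mu> l) R (V 0) \<le> 1"
proof -
  \<comment> \<open>After summing over the \<open>n + 1\<close> indices \<open>j\<close>, each of the three contributions gets the factor \<open>1 / 4\<close>.\<close>
  define d where "d = 1 / (4 * (real n + 1) * B)"
  have d: "0 < d" "(real n + 1) * (B * d) = 1 / 4" using B(1) by (auto simp: d_def)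
  define a where "a j = gcoeff (E j) 0" for j
  define e where "e j = E j - gmonom (a j) 0" for j
  have e_coeff: "gcoeff (e j) t = (if t = 0 then 0 else gcoeff (E j) t)" for j t
    by (simp add: e_def a_def)
  have e_fin: "finite (gsupp (e j))" if "j \<le> n" for j
    by (rule finite_subset[OF _ E(1)[OF that]]) (auto simp: gsupp_def e_coeff)
  have e_pos: "exp_less 0 t" if "j \<le> n" "t \<in> gsupp (e j)" for j t
    using E(2)[of j t] that by (auto simp: gsupp_def e_coeff exp_le_def split: if_splits)
  have e_nonneg: "gsupp (e j) \<subseteq> {t. 0 \<le> Re t}" if "j \<le> n" for j
    using e_pos[OF that] by (force simp: exp_less_def)
  have "\<forall>\<^sub>F l in at_top. \<forall>\<^sub>F \<mu> in at_bot. \<forall>R. wnorm (Complex \<mu> l) R f \<le> d"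
    by (rule wnorm_small[OF f _ d(1)]) (simp add: f_pos exp_less_def)
  moreover have "\<forall>\<^sub>F l in at_top. \<forall>j\<in>{..n}. \<forall>\<^sub>F \<mu> in at_bot. \<forall>R. wnorm (Complex \<mu> l) R (e j) \<le> d"
    using wnorm_small[OF e_fin e_pos d(1)] by (intro eventually_ball_finite) auto
  ultimately show ?thesis
  proof eventually_elim
    case (elim l)
    have "\<forall>g\<in>G. \<exists>M. \<forall>\<mu>\<le>0. \<forall>R. wnorm (Complex \<mu> l) R g \<le> M"
    proof
      fix g assume "g \<in> G"
      then show "\<exists>M. \<forall>\<mu>\<le>0. \<forall>R. wnorm (Complex \<mu> l) R g \<le> M"
        using generators_nonneg by (intro wnorm_bounded G) auto
    qed
    then obtain M where M: "\<And>g \<mu> R. g \<in> G \<Longrightarrow> \<mu> \<le> 0 \<Longrightarrow> wnorm (Complex \<mu> l) R g \<le> M g" by metis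
    \<comment> \<open>\<open>1\<close> is the bound that the induction provides for the generators \<open>V j\<close>.\<close>
    define M' where "M' = Max (insert 1 (M ` G))"
    have M': "1 \<le> M'" "\<And>g. g \<in> G \<Longrightarrow> M g \<le> M'"
      unfolding M'_def using G(1) by (auto intro!: Max_ge)
    obtain C where C: "\<And>z R. \<forall>g\<in>G \<union> V ` {..n}. wnorm z R g \<le> M' \<Longrightarrow> wnorm z R S \<le> C"
      using subalgebra_wnorm_bounded[OF S generators_nonneg, of M'] by blast
    have "\<forall>\<^sub>F \<mu> in at_bot. norm (of_real (\<bar>C\<bar> + 1) * exp (Complex \<mu> l * \<kappa>)) < d"
      using \<kappa> d(1) by (intro eventually_weight_small) auto
    moreover have "\<forall>\<^sub>F \<mu> in at_bot. \<forall>j\<in>{..n}. \<forall>R. wnorm (Complex \<mu> l) R (e j) \<le> d"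
      using elim(2) by (intro eventually_ball_finite) auto
    moreover note elim(1)
    ultimately have "\<forall>\<^sub>F \<mu> in at_bot. \<mu> \<le> 0 \<and> norm (of_real (\<bar>C\<bar> + 1) * exp (Complex \<mu> l * \<kappa>)) < d
        \<and> (\<forall>j\<in>{..n}. \<forall>R. wnorm (Complex \<mu> l) R (e j) \<le> d) \<and> (\<forall>R. wnorm (Complex \<mu> l) R f \<le> d)"
      using eventually_le_at_bot[of 0] by eventually_elim blast
    then obtain \<mu> where "\<mu> \<le> 0" and \<mu>: "norm (of_real (\<bar>C\<bar> + 1) * exp (Complex \<mu> l * \<kappa>)) < d"
        "\<forall>j\<in>{..n}. \<forall>R. wnorm (Complex \<mu> l) R (e j) \<le> d" "\<forall>R. wnorm (Complex \<mu> l) R f \<le> d"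
      using eventually_happens'[OF trivial_limit_at_bot_linorder] by blast
    define z where "z = Complex \<mu> l"
    define X where "X R = (\<Sum>j\<le>n. wnorm z R (V j))" for R
    have wV: "wnorm z R (V j) \<le> X R" if "j \<le> n" for j R
      unfolding X_def using that by (intro member_le_sum wnorm_nonneg) auto
    have "X (real k) \<le> 1" for k
    proof (induction k)
      case 0
      have none: "{t. gcoeff (V j) t \<noteq> 0 \<and> Re t \<le> 0} = {}" for j
        using V_j_pos[of _ j] unfolding gsupp_def by force
      show ?case by (simp add: X_def wnorm_def none)
    next
      case (Suc k)
      let ?R = "real (Suc k)"
      have "wnorm z (real k) g \<le> M'" if "g \<in> G \<union> V ` {..n}" for g
        using that
      proof
        assume "g \<in> G"
        then show ?thesis using M[OF _ \<open>\<mu> \<le> 0\<close>] M'(2) unfolding z_def by (meson order_trans)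
      next
        assume "g \<in> V ` {..n}"
        then show ?thesis using wV[of _ "real k"] Suc.IH M'(1) by force
      qed
      then have "wnorm z (real k) S \<le> C" by (intro C) blast
      then have "wnorm z (?R - Re \<kappa>) S \<le> \<bar>C\<bar> + 1"
        using wnorm_mono[of "?R - Re \<kappa>" "real k" z S] \<kappa> by simp
      then have "wnorm z ?R (gmonom 1 \<kappa> * S) \<le> norm (exp (z * \<kappa>)) * (\<bar>C\<bar> + 1)"
        unfolding wnorm_gmonom_mult by (intro mult_left_mono) auto
      also have "\<dots> \<le> d" using \<mu>(1) unfolding z_def norm_mult norm_of_real by (simp add: mult.commute)
      finally have nl: "wnorm z ?R (gmonom 1 \<kappa> * S) \<le> d" .
      have lin: "wnorm z ?R (e j * V j) \<le> d * wnorm z ?R (V j)" if "j \<le> n" for j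
      proof -
        have "wnorm z ?R (e j * V j) \<le> wnorm z ?R (e j) * wnorm z ?R (V j)"
          using that e_nonneg generators_nonneg[of "V j"] by (intro wnorm_mult) auto
        also have "\<dots> \<le> d * wnorm z ?R (V j)"
          using \<mu>(2) that unfolding z_def by (intro mult_right_mono wnorm_nonneg) auto
        finally show ?thesis .
      qed
      define P where "P = (\<Sum>j\<le>n. gmonom (a j) 0 * V j)"
      have "P = - (f + (\<Sum>j\<le>n. e j * V j) + gmonom 1 \<kappa> * S)"
        unfolding f_eq P_def e_def by (simp add: left_diff_distrib sum_subtractf)
      then have "wnorm z ?R P = wnorm z ?R (f + (\<Sum>j\<le>n. e j * V j) + gmonom 1 \<kappa> * S)"
        by (simp only: wnorm_uminus)
      also have "\<dots> \<le> wnorm z ?R f + wnorm z ?R (\<Sum>j\<le>n. e j * V j) + wnorm z ?R (gmonom 1 \<kappa> * S)"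
        using wnorm_add[of z ?R "f + (\<Sum>j\<le>n. e j * V j)" "gmonom 1 \<kappa> * S"]
          wnorm_add[of z ?R f "\<Sum>j\<le>n. e j * V j"] by simp
      also have "\<dots> \<le> d + (\<Sum>j\<le>n. d * wnorm z ?R (V j)) + d"
      proof (intro add_mono nl)
        show "wnorm z ?R f \<le> d" using \<mu>(3) unfolding z_def ..
        show "wnorm z ?R (\<Sum>j\<le>n. e j * V j) \<le> (\<Sum>j\<le>n. d * wnorm z ?R (V j))"
          by (rule order_trans[OF wnorm_sum sum_mono], rule lin) simp
      qed
      finally have P: "wnorm z ?R P \<le> d + d * X ?R + d"
        by (simp add: X_def sum_distrib_left)
      have P_coeff: "gcoeff P t = (\<Sum>i\<le>n. a i * (t + T) ^ i) * gcoeff (V 0) t" for t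
      proof -
        have "gcoeff P t = (\<Sum>i\<le>n. a i * gcoeff (V i) t)" by (simp add: P_def gcoeff_sum)
        also have "\<dots> = (\<Sum>i\<le>n. a i * ((t + T) ^ i * gcoeff (V 0) t))"
          by (intro sum.cong refl arg_cong[where f = "(*) _"] V)
        finally show ?thesis by (simp add: sum_distrib_right mult.assoc)
      qed
      have "wnorm z ?R (V j) \<le> B * wnorm z ?R P" if j: "j \<le> n" for j
      proof -
        let ?A = "{t. gcoeff (V 0) t \<noteq> 0 \<and> Re t \<le> ?R}"
        have "wnorm z ?R (V j) \<le> (\<Sum>t\<in>?A. norm (gcoeff (V j) t * exp (z * t)))"
          by (rule wnorm_le_sum[OF finite_gcoeff]) (auto simp: V[of j])
        also have "\<dots> \<le> (\<Sum>t\<in>?A. B * norm (gcoeff P t * exp (z * t)))"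
        proof (rule sum_mono)
          fix t assume "t \<in> ?A"
          then have "0 < Re t" using V_pos by (simp add: gsupp_def)
          from mult_right_mono[OF B(2)[OF this j], of "norm (gcoeff (V 0) t * exp (z * t))"]
          show "norm (gcoeff (V j) t * exp (z * t)) \<le> B * norm (gcoeff P t * exp (z * t))"
            by (simp add: V[of j t] P_coeff norm_mult norm_power a_def mult.assoc)
        qed
        also have "\<dots> \<le> B * wnorm z ?R P"
          unfolding sum_distrib_left[symmetric] using B(1)
          by (intro mult_left_mono sum_le_wnorm finite_gcoeff) auto
        finally show ?thesis .
      qed
      then have "wnorm z ?R (V j) \<le> B * (d + d * X ?R + d)" if "j \<le> n" for j
        using P B(1) that by (meson less_imp_le mult_left_mono order_trans)
      then have "X ?R \<le> (\<Sum>j\<le>n. B * (d + d * X ?R + d))"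
        unfolding X_def[of ?R] by (intro sum_mono) (simp add: X_def)
      also have "\<dots> = ((real n + 1) * (B * d)) * (1 + X ?R + 1)" by (simp add: algebra_simps)
      finally show ?case unfolding d(2) by simp
    qed
    then have "wnorm z R (V 0) \<le> 1" for R
      using wV[of 0 "real (nat \<lceil>R\<rceil>)"] wnorm_mono[of R "real (nat \<lceil>R\<rceil>)" z "V 0"]
      by (meson le0 order_trans real_nat_ceiling_ge)
    then show ?case unfolding z_def by blast
  qed
qed

text \<open>
  Among the exponents violating the bound there would be one, \<open>t\<close>, of least real part and, on that
  vertical line, of greatest imaginary part. In the coefficient of the equation at \<open>t + \<i> b\<close> everything
  else vanishes: what comes from exponents of smaller real part lies in the cone, too low to reach
  \<open>t + \<i> b\<close>, and on the same line only the top coefficients of the \<open>E j\<close> reach it. What is left is a value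
  of the polynomial in assumption \<open>top\<close> times the coefficient at \<open>t\<close>, which is nonzero.
\<close>

theorem V_cone: "\<exists>C. \<forall>t\<in>gsupp (V 0). Im t \<le> C * Re t"
proof -
  define P where "P = gsupp f \<union> (\<Union>g\<in>G. gsupp g) \<union> (\<Union>j\<le>n. {t\<in>gsupp (E j). 0 < Re t})"
  have P: "finite P" "\<And>t. t \<in> P \<Longrightarrow> 0 < Re t"
    unfolding P_def using f G E(1) f_pos by auto
  \<comment> \<open>A bound for the slopes of the known exponents, and for \<open>\<bar>Im \<kappa>\<bar> / Re \<kappa>\<close> since \<open>Re \<kappa> \<ge> 1\<close>: subtracting \<open>\<kappa>\<close> from an exponent above the cone leaves it above.\<close>
  define C where "C = Max (insert \<bar>Im \<kappa>\<bar> ((\<lambda>t. Im t / Re t) ` P))"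
  have C\<kappa>: "\<bar>Im \<kappa>\<bar> \<le> C" unfolding C_def using P by (intro Max_ge) auto
  have CP: "Im t \<le> C * Re t" if "t \<in> P" for t
  proof -
    have "Im t / Re t \<le> C" unfolding C_def using P that by (intro Max_ge) auto
    then show ?thesis using P(2)[OF that] by (simp add: divide_le_eq)
  qed
  have "Im t0 \<le> C * Re t0" if t0: "t0 \<in> gsupp (V 0)" for t0
  proof (rule ccontr)
    assume violated: "\<not> ?thesis"
    define A where "A = {t\<in>gsupp (V 0). Re t \<le> Re t0 \<and> C * Re t < Im t}"
    have A: "finite A" "A \<noteq> {}"
      using t0 violated finite_subset[OF _ finite_gcoeff[of "V 0" "Re t0"], of A]
      unfolding A_def gsupp_def by auto
    define A' where "A' = {t\<in>A. Re t = Min (Re ` A)}"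
    have "Min (Re ` A) \<in> Re ` A" using A by (intro Min_in) auto
    then obtain t1 where "t1 \<in> A'" unfolding A'_def by fastforce
    then have A': "finite A'" "A' \<noteq> {}" using A(1) by (auto simp: A'_def)
    then have "Max (Im ` A') \<in> Im ` A'" by (intro Max_in) auto
    then obtain t where t: "t \<in> A'" "Im t = Max (Im ` A')" by auto
    have tA: "t \<in> gsupp (V 0)" "Re t \<le> Re t0" "C * Re t < Im t"
      using t(1) unfolding A'_def A_def by auto
    have lower: "Im u \<le> C * Re u" if "u \<in> gsupp (V 0)" "Re u < Re t" for u
    proof (rule ccontr)
      assume "\<not> ?thesis"
      then have "u \<in> A" using that tA(2) by (simp add: A_def)
      then have "Min (Re ` A) \<le> Re u" using A(1) by simp
      then show False using t(1) that(2) by (simp add: A'_def)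
    qed
    have upper: "Im u \<le> Im t" if "u \<in> gsupp (V 0)" "Re u = Re t" for u
    proof (rule ccontr)
      assume less: "\<not> ?thesis"
      then have "u \<in> A'" using that tA t(1) by (simp add: A'_def A_def)
      then show False using t(2) A'(1) less by simp
    qed
    define w where "w = t + Complex 0 b"
    have w: "Re w = Re t" "C * Re w < Im w" using tA(3) b(1) by (auto simp: w_def)
    have "0 < Re t" using V_pos tA(1) .
    have "gcoeff f w = 0"
      using CP[of w] w by (auto simp: P_def gsupp_def)
    moreover have "gcoeff (gmonom 1 \<kappa> * S) w = 0"
    proof (rule ccontr)
      assume "\<not> ?thesis"
      then have "w - \<kappa> \<in> gsupp S" by (simp add: gsupp_def)
      moreover have "Im u \<le> C * Re u" if "g \<in> G \<union> V ` {..n}" "u \<in> gsupp g" "Re u < Re t" for g u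
        using that(1)
      proof
        assume "g \<in> G"
        then show ?thesis using CP that(2) by (auto simp: P_def)
      next
        assume "g \<in> V ` {..n}"
        then have "u \<in> gsupp (V 0)" using that(2) gsupp_V by blast
        then show ?thesis using lower that(3) by blast
      qed
      ultimately have "Im (w - \<kappa>) \<le> C * Re (w - \<kappa>)"
        using subalgebra_cone[OF S generators_nonneg, of "Re t" C "w - \<kappa>"] \<kappa> w(1) by auto
      moreover have "C * 1 \<le> C * Re \<kappa>" using \<kappa> C\<kappa> by (intro mult_left_mono) auto
      ultimately show False using w(2) C\<kappa> by (simp add: right_diff_distrib)
    qed
    moreover have "gcoeff (E j * V j) w = gcoeff (E j) (Complex 0 b) * ((t + T) ^ j * gcoeff (V 0) t)"
      if j: "j \<le> n" for j
    proof -
      have "u = Complex 0 b" if u: "gcoeff (E j) u \<noteq> 0" "gcoeff (V j) (w - u) \<noteq> 0" for u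
      proof -
        have uE: "u \<in> gsupp (E j)" using u(1) by (simp add: gsupp_def)
        have uV: "w - u \<in> gsupp (V 0)" using u(2) V[of j "w - u"] by (auto simp: gsupp_def)
        show ?thesis
        proof (cases "0 < Re u")
          case True
          then have "Im u \<le> C * Re u" using CP uE j by (auto simp: P_def)
          moreover have "Im (w - u) \<le> C * Re (w - u)" using lower[OF uV] True w(1) by simp
          ultimately show ?thesis using w(2) by (simp add: right_diff_distrib)
        next
          case False
          then have "Re u = 0" using E_nonneg[OF j uE] by simp
          moreover have "Im u \<le> b" using b(2)[OF j uE] \<open>Re u = 0\<close> .
          moreover have "Im (w - u) \<le> Im t" using upper[OF uV] \<open>Re u = 0\<close> w(1) by simp
          ultimately show ?thesis by (simp add: w_def complex_eq_iff)
        qed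
      qed
      then have "gcoeff (E j * V j) w
          = (\<Sum>u\<in>{Complex 0 b}. gcoeff (E j) u * gcoeff (V j) (w - u))"
        by (intro gcoeff_times_eq) auto
      then show ?thesis using V[of j t] by (simp add: w_def)
    qed
    moreover have "gcoeff f w + (\<Sum>j\<le>n. gcoeff (E j * V j) w) + gcoeff (gmonom 1 \<kappa> * S) w = 0"
      using arg_cong[OF eq, of "\<lambda>g. gcoeff g w"] by (simp only: gcoeff_simps gcoeff_sum)
    ultimately have "(\<Sum>j\<le>n. gcoeff (E j) (Complex 0 b) * (t + T) ^ j) * gcoeff (V 0) t = 0"
      by (simp add: sum_distrib_right mult.assoc del: gcoeff_gmonom_mult)
    then show False using top[OF \<open>0 < Re t\<close>] tA(1) by (simp add: gsupp_def)
  qed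
  then show ?thesis by blast
qed

end

section \<open>Truncation and reduction\<close>

lemma finite_support_truncate:
  assumes "\<And>R. finite {t. f t \<noteq> (0::complex) \<and> Re t \<le> R}"
  shows "finite {t. (if Re t \<le> T then f t else 0) \<noteq> 0 \<and> Re t \<le> R}"
  using assms[of R] by (rule rev_finite_subset) auto

lift_definition gtrunc :: "real \<Rightarrow> gpseries \<Rightarrow> gpseries"
  is "\<lambda>T f t. if Re t \<le> T then f t else 0"
  by (rule finite_support_truncate)

lemma gcoeff_gtrunc [simp]: "gcoeff (gtrunc T f) t = (if Re t \<le> T then gcoeff f t else 0)"
  by (simp add: gtrunc.rep_eq)

lemma finite_gsupp_gtrunc: "finite (gsupp (gtrunc T f))"
  by (rule finite_subset[OF _ finite_gcoeff[of f T]]) (auto simp: gsupp_def)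

lemma finite_cpoly_vars: "finite (cpoly_vars F)"
  unfolding cpoly_vars_def by simp

lemma gjet_0: "gjet f 0 = gmonom 1 1"
  by (simp add: gjet_def)

lemma gcoeff_gjet_Suc: "gcoeff (gjet f (Suc j)) t = t ^ j * gcoeff f t"
  by (simp add: gjet_def gcoeff_delta_power)

lemma finite_gsupp_gjet: "finite (gsupp f) \<Longrightarrow> finite (gsupp (gjet f i))"
  by (cases i) (auto simp: gjet_0 gsupp_def gcoeff_gjet_Suc elim: rev_finite_subset)

text \<open>
  Changing the arguments at real parts \<open>\<ge> T\<close> changes the value only at real parts
  \<open>\<ge> T - K * cdeg F\<close>. Hence the leading behaviour of the partial derivatives survives
  truncation of the series.
\<close>

lemma gcoeff_cpoly_eval_perturb:
  fixes K T :: real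
  assumes a: "\<And>i t. t \<in> gsupp (a i) \<Longrightarrow> - K \<le> Re t" and w: "\<And>i t. t \<in> gsupp (w i) \<Longrightarrow> 0 \<le> Re t"
    and "0 \<le> K" "0 \<le> T" and t: "Re t < T - K * real (cdeg F)"
  shows "gcoeff (cpoly_eval F (\<lambda>i. a i + gmonom 1 (of_real T) * w i)) t = gcoeff (cpoly_eval F a) t"
proof -
  let ?G = "{f. gsupp f \<subseteq> {t. 0 \<le> Re t}}"
  let ?y = "gmonom 1 (of_real K)" and ?h = "gmonom 1 (of_real T)"
  have nonneg: "0 \<le> Re u" if "f \<in> subalgebra ?G" "gcoeff f u \<noteq> 0" for f u
    using subalgebra_gsupp[OF that(1)] that(2) by (auto simp: gsupp_def)
  have y: "?y \<in> subalgebra ?G" and h: "?h \<in> subalgebra ?G"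
    using \<open>0 \<le> K\<close> \<open>0 \<le> T\<close> by (auto simp: gsupp_def intro!: subalgebra.gen split: if_splits)
  have "?y * a i \<in> subalgebra ?G" "w i \<in> subalgebra ?G" for i
    using a[of _ i] w[of _ i] by (force simp: gsupp_def intro!: subalgebra.gen)+
  then have "first_order (subalgebra ?G) ?y ?h (cdeg F) (cpoly_eval F (\<lambda>i. a i + ?h * w i)) (cpoly_eval F a)
      (\<Sum>i\<in>cpoly_vars F. cpoly_eval (cpoly_pderiv i F) a * w i)"
    by (intro first_order_cpoly_eval[OF refl y h] finite_cpoly_vars) auto
  then obtain e1 s where e1: "?y ^ cdeg F * e1 \<in> subalgebra ?G" and s: "?y ^ cdeg F * s \<in> subalgebra ?G"
    and eq: "cpoly_eval F (\<lambda>i. a i + ?h * w i) = cpoly_eval F a + ?h * e1 + ?h\<^sup>2 * s"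
    unfolding first_order_def by blast
  have "?y ^ cdeg F * (e1 + ?h * s) \<in> subalgebra ?G"
    using subalgebra.add[OF e1 subalgebra.mult[OF h s]] by (simp add: algebra_simps)
  then have "gcoeff (?y ^ cdeg F * (e1 + ?h * s)) (t - of_real T + of_real (real (cdeg F) * K)) = 0"
    using nonneg t by (fastforce simp: mult.commute)
  then have "gcoeff (e1 + ?h * s) (t - of_real T) = 0"
    by (simp add: gmonom_power)
  then have "gcoeff (?h * (e1 + ?h * s)) t = 0"
    by simp
  moreover have "cpoly_eval F (\<lambda>i. a i + ?h * w i) = cpoly_eval F a + ?h * (e1 + ?h * s)"
    unfolding eq by (simp add: algebra_simps power2_eq_square)
  ultimately show ?thesis by (simp del: gcoeff_gmonom_mult)
qed

text \<open>
  For large arguments the leading term is at least twice as large as all others together.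
\<close>

lemma polynomial_dominates:
  fixes a :: "nat \<Rightarrow> complex"
  assumes "a n \<noteq> 0"
  shows "\<exists>B>0. \<exists>T. \<forall>\<tau> j. T \<le> norm \<tau> \<longrightarrow> j \<le> n \<longrightarrow> norm \<tau> ^ j \<le> B * norm (\<Sum>i\<le>n. a i * \<tau> ^ i)"
proof -
  define A where "A = (\<Sum>i<n. norm (a i))"
  define T where "T = max 1 (2 * A / norm (a n))"
  have "norm \<tau> ^ j \<le> 2 / norm (a n) * norm (\<Sum>i\<le>n. a i * \<tau> ^ i)" if \<tau>: "T \<le> norm \<tau>" and "j \<le> n" for \<tau> j
  proof -
    have \<tau>1: "1 \<le> norm \<tau>" and "2 * A / norm (a n) \<le> norm \<tau>" using \<tau> by (auto simp: T_def)
    then have A: "A \<le> norm (a n) * norm \<tau> / 2" using assms by (simp add: field_simps)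
    define X where "X = (\<Sum>i<n. norm (a i * \<tau> ^ i))"
    have "X * norm \<tau> \<le> (\<Sum>i<n. norm (a i) * norm \<tau> ^ n)"
      unfolding X_def sum_distrib_right
    proof (rule sum_mono)
      fix i assume "i \<in> {..<n}"
      then have "norm \<tau> ^ Suc i \<le> norm \<tau> ^ n" using \<tau>1 by (intro power_increasing) auto
      from mult_left_mono[OF this, of "norm (a i)"]
      show "norm (a i * \<tau> ^ i) * norm \<tau> \<le> norm (a i) * norm \<tau> ^ n"
        by (simp add: norm_mult norm_power algebra_simps)
    qed
    also have "\<dots> = A * norm \<tau> ^ n" by (simp add: A_def sum_distrib_right)
    also have "\<dots> \<le> (norm (a n) * norm \<tau> / 2) * norm \<tau> ^ n" using A by (intro mult_right_mono) auto
    finally have "X * norm \<tau> \<le> (norm (a n) * norm \<tau> ^ n / 2) * norm \<tau>" by (simp add: algebra_simps)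
    then have X: "X \<le> norm (a n) * norm \<tau> ^ n / 2" using \<tau>1 by (subst (asm) mult_le_cancel_right) auto
    have "a n * \<tau> ^ n = (\<Sum>i\<le>n. a i * \<tau> ^ i) - (\<Sum>i<n. a i * \<tau> ^ i)"
      by (simp flip: lessThan_Suc_atMost)
    then have "norm (a n * \<tau> ^ n) \<le> norm (\<Sum>i\<le>n. a i * \<tau> ^ i) + norm (\<Sum>i<n. a i * \<tau> ^ i)"
      by (metis norm_triangle_ineq4)
    also have "norm (\<Sum>i<n. a i * \<tau> ^ i) \<le> X" unfolding X_def by (rule norm_sum)
    finally have "norm (a n) * norm \<tau> ^ n / 2 \<le> norm (\<Sum>i\<le>n. a i * \<tau> ^ i)"
      using X by (simp add: norm_mult norm_power)
    then have "norm \<tau> ^ n \<le> 2 / norm (a n) * norm (\<Sum>i\<le>n. a i * \<tau> ^ i)"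
      using assms by (simp add: field_simps)
    moreover have "norm \<tau> ^ j \<le> norm \<tau> ^ n" using \<tau>1 \<open>j \<le> n\<close> by (rule power_increasing[rotated])
    ultimately show ?thesis by simp
  qed
  then show ?thesis using assms by (intro exI[of _ "2 / norm (a n)"]) auto
qed

lemma polynomial_no_large_roots:
  fixes a :: "nat \<Rightarrow> complex"
  assumes "i \<le> n" "a i \<noteq> 0"
  shows "\<exists>T. \<forall>\<tau>. T < norm \<tau> \<longrightarrow> (\<Sum>i\<le>n. a i * \<tau> ^ i) \<noteq> 0"
proof -
  have "finite {\<tau>. (\<Sum>i\<le>n. a i * \<tau> ^ i) = 0}"
    unfolding polyfun_finite_roots using assms by blast
  from finite_imp_bounded[OF this] obtain T
    where "\<And>\<tau>. (\<Sum>i\<le>n. a i * \<tau> ^ i) = 0 \<Longrightarrow> norm \<tau> \<le> T"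
    unfolding bounded_iff by auto
  then have "\<forall>\<tau>. T < norm \<tau> \<longrightarrow> (\<Sum>i\<le>n. a i * \<tau> ^ i) \<noteq> 0" by force
  then show ?thesis ..
qed

text \<open>
  The reduction. With \<open>\<gamma>\<close> the order of the derivative with respect to \<open>y\<^sub>n\<close>, the expansion of the
  equation at the truncated series is divided by \<open>x\<^bsup>\<gamma> + T\<^esup>\<close>. The quadratic remainder carries
  \<open>x\<^bsup>2 T\<^esup>\<close> against a loss of \<open>x\<^bsup>- K d\<^esup>\<close> that does not depend on \<open>T\<close>, which leaves \<open>x\<^sup>\<kappa>\<close> with
  \<open>Re \<kappa> = T - Re \<gamma> - K d\<close>.
\<close>

lemma tail_estimates:
  fixes F :: cpoly and \<phi> :: gpseries
  assumes vars: "cpoly_vars F \<subseteq> {..<n + 2}"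
    and sol: "cpoly_eval F (gjet \<phi>) = 0"
    and nz: "cpoly_eval (cpoly_pderiv (Suc n) F) (gjet \<phi>) \<noteq> 0"
    and ord: "\<And>j. j \<le> n \<Longrightarrow> cpoly_eval (cpoly_pderiv (Suc j) F) (gjet \<phi>) \<noteq> 0 \<Longrightarrow>
      gord (cpoly_eval (cpoly_pderiv (Suc j) F) (gjet \<phi>)) \<succeq>
      gord (cpoly_eval (cpoly_pderiv (Suc n) F) (gjet \<phi>))"
  shows "\<exists>T\<ge>0. (\<exists>C D. \<forall>u\<in>gsupp \<phi>. T < Re u \<longrightarrow> Im u \<le> C * Re u + D) \<and>
    (\<forall>\<^sub>F l in at_top. \<exists>\<mu> M. \<forall>A. finite A \<longrightarrow> A \<subseteq> {u. T < Re u} \<longrightarrow>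
      (\<Sum>u\<in>A. norm (gcoeff \<phi> u * exp (Complex \<mu> l * u))) \<le> M)"
proof -
  define H where "H j = cpoly_eval (cpoly_pderiv (Suc j) F) (gjet \<phi>)" for j
  define \<gamma> where "\<gamma> = gord (H n)"
  have H\<gamma>: "gcoeff (H n) \<gamma> \<noteq> 0" unfolding \<gamma>_def using nz gord_nonzero(1) unfolding H_def by blast
  have Hord: "\<gamma> \<preceq> t" if "j \<le> n" "gcoeff (H j) t \<noteq> 0" for j t
  proof -
    have "H j \<noteq> 0" using that(2) by auto
    then show ?thesis
      using ord[OF that(1)] gord_nonzero(2)[of "H j" t] that(2) exp_le_trans unfolding \<gamma>_def H_def by blast
  qed
  define Q where "Q = (\<Union>j\<le>n. {t. gcoeff (H j) t \<noteq> 0 \<and> Re t \<le> Re \<gamma>})"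
  have Q: "finite Q" unfolding Q_def using finite_gcoeff by blast
  define Z where "Z = (\<lambda>t. Im t - Im \<gamma>) ` {t\<in>Q. Re t = Re \<gamma>}"
  have "\<gamma> \<in> {t\<in>Q. Re t = Re \<gamma>}" using H\<gamma> by (auto simp: Q_def)
  from imageI[OF this, of "\<lambda>t. Im t - Im \<gamma>"] have Z: "finite Z" "0 \<in> Z"
    unfolding Z_def using Q by simp_all
  \<comment> \<open>The highest exponent of the derivatives on the vertical line through \<open>\<gamma>\<close>, relative to \<open>\<gamma>\<close>.\<close>
  define b where "b = Max Z"
  have b0: "0 \<le> b" unfolding b_def using Z by simp
  have "b \<in> Z" unfolding b_def using Z by (intro Max_in) auto
  then obtain t0 j0 where j0: "j0 \<le> n" "gcoeff (H j0) t0 \<noteq> 0"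
    and t0: "Re t0 = Re \<gamma>" "b = Im t0 - Im \<gamma>"
    by (auto simp: Z_def Q_def)
  have "t0 = \<gamma> + Complex 0 b" using t0 by (simp add: complex_eq_iff)
  note j0 = j0[unfolded this]
  obtain B T1 where B: "0 < B" "\<And>\<tau> j. T1 \<le> norm \<tau> \<Longrightarrow> j \<le> n \<Longrightarrow>
      norm \<tau> ^ j \<le> B * norm (\<Sum>i\<le>n. gcoeff (H i) \<gamma> * \<tau> ^ i)"
    using polynomial_dominates[of "\<lambda>i. gcoeff (H i) \<gamma>" n] H\<gamma> by blast
  obtain T2 where T2: "\<And>\<tau>. T2 < norm \<tau> \<Longrightarrow> (\<Sum>i\<le>n. gcoeff (H i) (\<gamma> + Complex 0 b) * \<tau> ^ i) \<noteq> 0"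
    using polynomial_no_large_roots[of j0 n "\<lambda>i. gcoeff (H i) (\<gamma> + Complex 0 b)"] j0 by blast
  obtain m where m: "\<And>t. gcoeff \<phi> t \<noteq> 0 \<Longrightarrow> m \<le> Re t"
    using support_bounded_below[of "gcoeff \<phi>"] finite_gcoeff by blast
  \<comment> \<open>All exponents of \<open>x, \<phi>, \<delta>\<phi>, \<dots>\<close> have real part strictly greater than \<open>- K\<close>; strictness keeps the generators off the imaginary axis.\<close>
  define K where "K = max 1 (1 - m)"
  have K: "1 \<le> K" "\<And>t. gcoeff \<phi> t \<noteq> 0 \<Longrightarrow> - K < Re t" unfolding K_def using m by force+
  define d where "d = cdeg F + (\<Sum>j\<le>n. cdeg (cpoly_pderiv (Suc j) F))"
  have d: "cdeg F \<le> d" "\<And>j. j \<le> n \<Longrightarrow> cdeg (cpoly_pderiv (Suc j) F) \<le> d"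
    unfolding d_def by (auto intro!: trans_le_add2 member_le_sum)
  \<comment> \<open>\<open>T1\<close> and \<open>T2\<close> serve the two polynomials; the last entry gives \<open>Re \<kappa> \<ge> 1\<close>.\<close>
  define T where "T = Max {1, T1, T2, Re \<gamma> + K * real d + 1}"
  have T: "1 \<le> T" "T1 \<le> T" "T2 \<le> T" "Re \<gamma> + K * real d + 1 \<le> T"
    unfolding T_def by auto
  define \<phi>T where "\<phi>T = gtrunc T \<phi>"
  define y where "y = gmonom 1 (of_real K)"
  define h where "h = gmonom 1 (of_real T)"
  define V where "V j = gmonom 1 (- of_real T) * (gdelta ^^ j) (\<phi> - \<phi>T)" for j
  have V_coeff: "gcoeff (V j) t = (t + of_real T) ^ j * gcoeff (\<phi> - \<phi>T) (t + of_real T)" for j t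
    by (simp add: V_def gcoeff_delta_power)
  have V_coeff': "gcoeff (V j) t = (t + of_real T) ^ j * gcoeff (V 0) t" for j t
    by (simp only: V_coeff) simp
  have V_pos: "0 < Re t" if "t \<in> gsupp (V j)" for j t
    using that by (auto simp: gsupp_def V_coeff \<phi>T_def split: if_splits)
  \<comment> \<open>Variable \<open>0\<close> is \<open>x\<close> itself, which is not perturbed.\<close>
  define w where "w i = (case i of 0 \<Rightarrow> 0 | Suc j \<Rightarrow> V j)" for i
  have w_simps: "w 0 = 0" "w (Suc j) = V j" for j by (simp_all add: w_def)
  have jet: "gjet \<phi> i = gjet \<phi>T i + h * w i" for i
  proof (cases i)
    case (Suc j)
    show ?thesis unfolding Suc w_simps h_def
      by (rule gpseries_eqI) (simp add: V_coeff gcoeff_gjet_Suc right_diff_distrib)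
  qed (simp add: gjet_0 w_simps)
  have jet_pos: "- K < Re t" if "t \<in> gsupp (gjet \<phi>T i)" for t i
    using that K by (cases i) (auto simp: gsupp_def gjet_0 gcoeff_gjet_Suc \<phi>T_def split: if_splits)
  have w_pos: "0 \<le> Re t" if "t \<in> gsupp (w i)" for t i
    using that V_pos by (cases i) (force simp: w_simps gsupp_def)+
  define HT where "HT j = cpoly_eval (cpoly_pderiv (Suc j) F) (gjet \<phi>T)" for j
  have HT: "gcoeff (HT j) t = gcoeff (H j) t" if "j \<le> n" "Re t \<le> Re \<gamma>" for j t
  proof -
    have "K * real (cdeg (cpoly_pderiv (Suc j) F)) \<le> K * real d"
      using d(2)[OF that(1)] K(1) by (intro mult_left_mono) auto
    then have "Re t < T - K * real (cdeg (cpoly_pderiv (Suc j) F))"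
      using T(4) that(2) by linarith
    then have "gcoeff (cpoly_eval (cpoly_pderiv (Suc j) F) (\<lambda>i. gjet \<phi>T i + gmonom 1 (of_real T) * w i)) t
        = gcoeff (HT j) t"
      unfolding HT_def using jet_pos w_pos K(1) T(1)
      by (intro gcoeff_cpoly_eval_perturb) (auto intro: less_imp_le)
    then show ?thesis unfolding H_def jet[abs_def] h_def by simp
  qed
  define E where "E j = gmonom 1 (- \<gamma>) * HT j" for j
  have E_coeff: "gcoeff (E j) t = gcoeff (H j) (\<gamma> + t)" if "j \<le> n" "Re t \<le> 0" for j t
    using HT[OF that(1), of "t + \<gamma>"] that(2) by (simp add: E_def add.commute)
  define G where "G = {y, h} \<union> (\<lambda>i. y * gjet \<phi>T i) ` {..<n + 2}"
  define A where "A = subalgebra (G \<union> V ` {..n})"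
  have yA: "y \<in> A" and hA: "h \<in> A" unfolding A_def G_def by (auto intro: subalgebra.gen)
  have "w i \<in> A" if "i < n + 2" for i
    using that unfolding A_def by (cases i) (auto simp: w_simps subalgebra_zero intro: subalgebra.gen)
  moreover have "y * gjet \<phi>T i \<in> A" if "i < n + 2" for i
    using that unfolding A_def G_def by (auto intro: subalgebra.gen)
  ultimately have "first_order A y h (cdeg F) (cpoly_eval F (\<lambda>i. gjet \<phi>T i + h * w i)) (cpoly_eval F (gjet \<phi>T))
      (\<Sum>i<n + 2. cpoly_eval (cpoly_pderiv i F) (gjet \<phi>T) * w i)"
    by (intro first_order_cpoly_eval[OF A_def yA hA] vars) auto
  then have "first_order A y h d 0 (cpoly_eval F (gjet \<phi>T))
      (\<Sum>i<n + 2. cpoly_eval (cpoly_pderiv i F) (gjet \<phi>T) * w i)"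
    using first_order_weaken[OF A_def yA hA _ d(1)] sol unfolding jet[abs_def] by simp
  moreover have "(\<Sum>i<n + 2. cpoly_eval (cpoly_pderiv i F) (gjet \<phi>T) * w i) = (\<Sum>j\<le>n. HT j * V j)"
  proof -
    have "{..<n + 2} = {..Suc n}" by auto
    then show ?thesis by (simp only: sum.atMost_Suc_shift w_simps HT_def) simp
  qed
  ultimately obtain s where s: "y ^ d * s \<in> A"
    and exp0: "0 = cpoly_eval F (gjet \<phi>T) + h * (\<Sum>j\<le>n. HT j * V j) + h\<^sup>2 * s"
    unfolding first_order_def by auto
  define f where "f = gmonom 1 (- \<gamma> - of_real T) * cpoly_eval F (gjet \<phi>T)"
  define \<kappa> where "\<kappa> = of_real T - \<gamma> - of_real (real d * K)"
  have eq: "f + (\<Sum>j\<le>n. E j * V j) + gmonom 1 \<kappa> * (y ^ d * s) = 0"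
  proof -
    have "gmonom 1 (- \<gamma> - of_real T) * h = gmonom 1 (- \<gamma>)" by (simp add: h_def gmonom_mult)
    then have "gmonom 1 (- \<gamma> - of_real T) * (h * (\<Sum>j\<le>n. HT j * V j)) = (\<Sum>j\<le>n. E j * V j)"
      by (simp add: E_def sum_distrib_left flip: mult.assoc)
    moreover have "gmonom 1 (- \<gamma> - of_real T) * (h\<^sup>2 * s) = gmonom 1 \<kappa> * (y ^ d * s)"
      by (simp add: h_def y_def \<kappa>_def gmonom_power gmonom_mult flip: mult.assoc)
    ultimately show ?thesis
      using arg_cong[OF exp0, of "\<lambda>g. gmonom 1 (- \<gamma> - of_real T) * g"]
      by (simp add: distrib_left f_def)
  qed
  have fin: "finite (gsupp (gjet \<phi>T i))" for i
    unfolding \<phi>T_def by (intro finite_gsupp_gjet finite_gsupp_gtrunc)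
  interpret reduced_equation n "of_real T" V E f "y ^ d * s" G \<kappa> B b
  proof
    show "gcoeff (V j) t = (t + of_real T) ^ j * gcoeff (V 0) t" for j t by (rule V_coeff')
    show "0 < Re t" if "t \<in> gsupp (V 0)" for t using V_pos that .
    show "finite G" unfolding G_def by simp
    show "finite (gsupp g)" if "g \<in> G" for g
      using that fin unfolding G_def y_def h_def by (auto intro: finite_gsupp_mult)
    show "0 < Re t" if "g \<in> G" "t \<in> gsupp g" for g t
      using that K(1) T(1) jet_pos[of "t - of_real K"] unfolding G_def y_def h_def
      by (auto simp: gsupp_def split: if_splits)
    show "finite (gsupp (E j))" for j
      unfolding E_def HT_def by (intro finite_gsupp_mult finite_gsupp_eval fin) simp
    show "0 \<preceq> t" if "j \<le> n" "t \<in> gsupp (E j)" for j t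
    proof (cases "0 < Re t")
      case False
      then have "gcoeff (H j) (\<gamma> + t) \<noteq> 0" using that E_coeff[of j t] by (simp add: gsupp_def)
      then show ?thesis using Hord[OF that(1)] by (fastforce simp: exp_le_def exp_less_def)
    qed (simp add: exp_le_def exp_less_def)
    show "finite (gsupp f)"
      unfolding f_def by (intro finite_gsupp_mult finite_gsupp_eval fin) simp
    show "y ^ d * s \<in> subalgebra (G \<union> V ` {..n})" using s unfolding A_def .
    show "1 \<le> Re \<kappa>" using T(4) by (simp add: \<kappa>_def mult.commute)
    show "f + (\<Sum>j\<le>n. E j * V j) + gmonom 1 \<kappa> * (y ^ d * s) = 0" by (rule eq)
    show "0 < B" by (rule B)
    show "0 \<le> b" by (rule b0)
    have large: "T < norm (t + of_real T)" if "0 < Re t" for t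
      using complex_Re_le_cmod[of "t + of_real T"] that by simp
    show "norm (t + of_real T) ^ j \<le> B * norm (\<Sum>i\<le>n. gcoeff (E i) 0 * (t + of_real T) ^ i)"
      if "0 < Re t" "j \<le> n" for t j
      using B(2)[OF _ that(2), of "t + of_real T"] large[OF that(1)] T(2) by (simp add: E_coeff)
    show "(\<Sum>i\<le>n. gcoeff (E i) (Complex 0 b) * (t + of_real T) ^ i) \<noteq> 0" if "0 < Re t" for t
      using T2[of "t + of_real T"] large[OF that] T(3) by (simp add: E_coeff)
    show "Im t \<le> b" if "j \<le> n" "t \<in> gsupp (E j)" "Re t = 0" for j t
    proof -
      have "gcoeff (H j) (\<gamma> + t) \<noteq> 0" using that E_coeff[of j t] by (simp add: gsupp_def)
      then have "\<gamma> + t \<in> {t\<in>Q. Re t = Re \<gamma>}" using that by (auto simp: Q_def)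
      then have "Im (\<gamma> + t) - Im \<gamma> \<in> Z" unfolding Z_def by (rule imageI)
      then show ?thesis unfolding b_def using Z(1) by simp
    qed
  qed
  have \<phi>V: "gcoeff \<phi> u = gcoeff (V 0) (u - of_real T)" if "T < Re u" for u
    using that by (simp add: V_coeff \<phi>T_def)
  obtain C where C: "\<And>t. t \<in> gsupp (V 0) \<Longrightarrow> Im t \<le> C * Re t" using V_cone by blast
  show ?thesis
  proof (rule exI[of _ T], intro conjI)
    show "0 \<le> T" using T(1) by simp
    have "Im u \<le> C * Re u + - C * T" if "u \<in> gsupp \<phi>" "T < Re u" for u
      using C[of "u - of_real T"] that \<phi>V[of u] by (simp add: gsupp_def right_diff_distrib)
    then show "\<exists>C D. \<forall>u\<in>gsupp \<phi>. T < Re u \<longrightarrow> Im u \<le> C * Re u + D" by blast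
    show "\<forall>\<^sub>F l in at_top. \<exists>\<mu> M. \<forall>A. finite A \<longrightarrow> A \<subseteq> {u. T < Re u} \<longrightarrow>
      (\<Sum>u\<in>A. norm (gcoeff \<phi> u * exp (Complex \<mu> l * u))) \<le> M"
      using wnorm_V_bounded
    proof eventually_elim
      case (elim l)
      then obtain \<mu> where \<mu>: "\<And>R. wnorm (Complex \<mu> l) R (V 0) \<le> 1" by blast
      define z where "z = Complex \<mu> l"
      have "(\<Sum>u\<in>A. norm (gcoeff \<phi> u * exp (z * u))) \<le> norm (exp (z * of_real T))"
        if A: "finite A" "A \<subseteq> {u. T < Re u}" for A
      proof -
        define A' where "A' = (\<lambda>u. u - of_real T) ` A"
        have "(\<Sum>u\<in>A. norm (gcoeff \<phi> u * exp (z * u)))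
            = (\<Sum>u\<in>A. norm (exp (z * of_real T)) * norm (gcoeff (V 0) (u - of_real T) * exp (z * (u - of_real T))))"
        proof (intro sum.cong refl)
          fix u assume "u \<in> A"
          have "exp (z * u) = exp (z * of_real T) * exp (z * (u - of_real T))"
            by (simp add: right_diff_distrib flip: exp_add)
          then show "norm (gcoeff \<phi> u * exp (z * u))
              = norm (exp (z * of_real T)) * norm (gcoeff (V 0) (u - of_real T) * exp (z * (u - of_real T)))"
            using \<phi>V[of u] A(2) \<open>u \<in> A\<close> by (auto simp: norm_mult)
        qed
        also have "\<dots> = norm (exp (z * of_real T)) * (\<Sum>t\<in>A'. norm (gcoeff (V 0) t * exp (z * t)))"
          unfolding A'_def by (simp add: sum.reindex inj_on_def sum_distrib_left)
        also have "(\<Sum>t\<in>A'. norm (gcoeff (V 0) t * exp (z * t))) \<le> wnorm z (Max (insert 0 (Re ` A'))) (V 0)"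
        proof (rule sum_le_wnorm)
          show "finite A'" using A(1) by (simp add: A'_def)
          then show "A' \<subseteq> {t. Re t \<le> Max (insert 0 (Re ` A'))}" by auto
        qed
        also have "\<dots> \<le> 1" unfolding z_def by (rule \<mu>)
        finally show ?thesis by simp
      qed
      then show ?case unfolding z_def by blast
    qed
  qed
qed

section \<open>Branches of the logarithm and uniform convergence\<close>

text \<open>
  The imaginary part of \<open>L\<close> differs from the angle used to parametrize the cone by a continuous function with values
  in the multiples of \<open>2 * pi\<close>, which is constant on the connected parameter domain.
\<close>

lemma log_branch_on_cone:
  assumes "log_branch_on L (open_cone \<alpha> \<beta>)"
  obtains k where "\<And>x. x \<in> open_cone \<alpha> \<beta> \<Longrightarrow> \<alpha> + k \<le> Im (L x) \<and> Im (L x) \<le> \<beta> + k"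
proof -
  define S where "S = {0::real<..} \<times> {\<alpha><..<\<beta>}"
  define p where "p = (\<lambda>(r, \<theta>). complex_of_real r * cis \<theta>)"
  define g where "g q = Im (L (p q)) - snd q" for q
  have pS: "p ` S = open_cone \<alpha> \<beta>"
    unfolding p_def S_def open_cone_def by (force simp: image_iff)
  have "continuous_on (p ` S) L"
    using assms unfolding log_branch_on_def pS by (blast intro: holomorphic_on_imp_continuous_on)
  moreover have "continuous_on S p"
    unfolding p_def case_prod_beta by (intro continuous_intros)
  ultimately have cont: "continuous_on S g"
    unfolding g_def by (intro continuous_intros continuous_on_compose2[of "p ` S" L S p]) auto
  have period: "\<exists>m::int. g q = 2 * pi * of_int m" if "q \<in> S" for q
  proof -
    obtain r \<theta> where q: "q = (r, \<theta>)" by (cases q)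
    have "0 < r" using that q by (simp add: S_def)
    have "exp (L (p q)) = p q"
      using assms that pS unfolding log_branch_on_def by blast
    also have "p q = exp (Complex (ln r) \<theta>)"
      using \<open>0 < r\<close> by (simp add: q p_def exp_eq_polar exp_of_real[symmetric])
    finally obtain m :: int where "L (p q) = Complex (ln r) \<theta> + complex_of_real (of_int (2 * m) * pi) * \<i>"
      unfolding exp_eq by blast
    then have "g q = 2 * pi * of_int m" by (simp add: g_def q)
    then show ?thesis ..
  qed
  have "g constant_on S"
  proof (rule continuous_discrete_range_constant)
    show "connected S"
      unfolding S_def by (intro connected_Times) auto
    show "continuous_on S g" by (rule cont)
    fix q assume q: "q \<in> S"
    have "2 * pi \<le> norm (g q' - g q)" if q': "q' \<in> S" "g q' \<noteq> g q" for q'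
    proof -
      obtain m m' :: int where m: "g q = 2 * pi * of_int m" "g q' = 2 * pi * of_int m'"
        using period q q'(1) by blast
      then have "m' - m \<noteq> 0" using q'(2) by auto
      then have "1 \<le> \<bar>m' - m\<bar>" by linarith
      then have "1 \<le> \<bar>real_of_int (m' - m)\<bar>" by linarith
      moreover have "g q' - g q = 2 * pi * real_of_int (m' - m)" by (simp add: m algebra_simps)
      ultimately show ?thesis by (simp add: abs_mult)
    qed
    then show "\<exists>e>0. \<forall>q'. q' \<in> S \<and> g q' \<noteq> g q \<longrightarrow> e \<le> norm (g q' - g q)"
      by (intro exI[of _ "2 * pi"]) auto
  qed
  then obtain k where k: "\<And>q. q \<in> S \<Longrightarrow> g q = k" unfolding constant_on_def by blast
  show thesis
  proof (rule that[of k])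
    fix x assume "x \<in> open_cone \<alpha> \<beta>"
    then obtain q where q: "q \<in> S" "x = p q" using pS by blast
    then have "Im (L x) = k + snd q" using k[OF q(1)] by (simp add: g_def)
    then show "\<alpha> + k \<le> Im (L x) \<and> Im (L x) \<le> \<beta> + k" using q(1) by (auto simp: S_def)
  qed
qed

theorem theorem1:
  fixes F :: cpoly and n :: nat and c s :: "nat \<Rightarrow> complex" and \<phi> :: gpseries
  assumes "F \<noteq> 0" and "cpoly_vars F \<subseteq> {..<n + 2}"
    and "\<And>k. s k \<prec> s (Suc k)"
    and "filterlim (\<lambda>k. Re (s k)) at_top sequentially"
    and "\<phi> = gseries c s"
    and "cpoly_eval F (gjet \<phi>) = 0"
    and "cpoly_eval (cpoly_pderiv (Suc n) F) (gjet \<phi>) \<noteq> 0"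
    and "\<And>j. j \<le> n \<Longrightarrow> cpoly_eval (cpoly_pderiv (Suc j) F) (gjet \<phi>) \<noteq> 0 \<Longrightarrow>
      gord (cpoly_eval (cpoly_pderiv (Suc j) F) (gjet \<phi>)) \<succeq>
      gord (cpoly_eval (cpoly_pderiv (Suc n) F) (gjet \<phi>))"
  shows "\<forall>\<alpha> \<beta> L. \<alpha> < \<beta> \<and> \<beta> - \<alpha> < 2 * pi \<and> log_branch_on L (open_cone \<alpha> \<beta>) \<longrightarrow>
    (\<exists>\<rho>\<^sub>0>0. \<forall>\<rho>. 0 < \<rho> \<and> \<rho> \<le> \<rho>\<^sub>0 \<longrightarrow>
      uniformly_convergent_on (sector \<alpha> \<beta> \<rho>) (\<lambda>N x. \<Sum>k<N. c k * exp (s k * L x)))"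
proof (intro allI impI, elim conjE)
  fix \<alpha> \<beta> :: real and L :: "complex \<Rightarrow> complex"
  assume L: "log_branch_on L (open_cone \<alpha> \<beta>)"
  have mono: "s i \<prec> s j" if "i < j" for i j
    using that
  proof (induction rule: strict_inc_induct)
    case (step i)
    then show ?case using assms(3)[of i] by (auto simp: exp_less_def)
  qed (use assms(3) in auto)
  have inj: "inj s"
    by (rule linorder_injI) (metis mono exp_less_def less_irrefl)
  have coeff: "gcoeff \<phi> (s k) = c k" for k
  proof -
    have "{k'. s k' = s k} = {k}" using inj by (auto dest: injD)
    then show ?thesis unfolding assms(5) gcoeff_gseries[OF assms(4)] by simp
  qed
  obtain T C0 D0 where "0 \<le> T"
    and cone0: "\<And>u. u \<in> gsupp \<phi> \<Longrightarrow> T < Re u \<Longrightarrow> Im u \<le> C0 * Re u + D0"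
    and conv: "\<forall>\<^sub>F l in at_top. \<exists>\<mu> M. \<forall>A. finite A \<longrightarrow> A \<subseteq> {u. T < Re u} \<longrightarrow>
      (\<Sum>u\<in>A. norm (gcoeff \<phi> u * exp (Complex \<mu> l * u))) \<le> M"
    using tail_estimates[OF assms(2,6,7,8)] by blast
  \<comment> \<open>With nonnegative constants the bound \<open>C * Re u + D\<close> is nonnegative, so that an angle multiplying it may be replaced by a larger one.\<close>
  define C D where "C = \<bar>C0\<bar>" and "D = \<bar>D0\<bar>"
  have CD: "0 \<le> C" "0 \<le> D" by (simp_all add: C_def D_def)
  have cone: "Im u \<le> C * Re u + D" if "u \<in> gsupp \<phi>" "T < Re u" for u
  proof -
    have "C0 * Re u \<le> C * Re u" using that \<open>0 \<le> T\<close> by (intro mult_right_mono) (auto simp: C_def)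
    then show ?thesis using cone0[OF that] by (simp add: D_def)
  qed
  obtain k where k: "\<And>x. x \<in> open_cone \<alpha> \<beta> \<Longrightarrow> \<alpha> + k \<le> Im (L x) \<and> Im (L x) \<le> \<beta> + k"
    using log_branch_on_cone[OF L] by blast
  have "\<forall>\<^sub>F l in at_top. \<beta> + k \<le> l \<and> (\<exists>\<mu> M. \<forall>A. finite A \<longrightarrow> A \<subseteq> {u. T < Re u} \<longrightarrow>
      (\<Sum>u\<in>A. norm (gcoeff \<phi> u * exp (Complex \<mu> l * u))) \<le> M)"
    using conv eventually_ge_at_top[of "\<beta> + k"] by eventually_elim blast
  then obtain l \<mu> M where l: "\<beta> + k \<le> l" and M: "\<And>A. finite A \<Longrightarrow> A \<subseteq> {u. T < Re u} \<Longrightarrow>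
      (\<Sum>u\<in>A. norm (gcoeff \<phi> u * exp (Complex \<mu> l * u))) \<le> M"
    using eventually_happens'[OF trivial_limit_at_top_linorder] by blast
  \<comment> \<open>\<open>W\<close> bounds the angle between the direction \<open>l\<close> of known convergence and the points of the sector.\<close>
  define z where "z = Complex \<mu> l"
  define W where "W = l - (\<alpha> + k)"
  have "\<forall>\<^sub>F j in sequentially. T < Re (s j)"
    using assms(4) by (simp add: filterlim_at_top_dense)
  then obtain N where N: "\<And>j. N \<le> j \<Longrightarrow> T < Re (s j)" by (auto simp: eventually_sequentially)
  have "summable (\<lambda>j. norm (c (j + N) * exp (z * s (j + N))))"
  proof (rule summableI_nonneg_bounded)
    fix m
    have inj': "inj_on (\<lambda>j. s (j + N)) {..<m}" using inj by (intro inj_onI) (auto dest: injD)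
    have "(\<Sum>j<m. norm (c (j + N) * exp (z * s (j + N))))
        = (\<Sum>u\<in>(\<lambda>j. s (j + N)) ` {..<m}. norm (gcoeff \<phi> u * exp (z * u)))"
      by (simp add: sum.reindex[OF inj'] coeff)
    also have "\<dots> \<le> M" unfolding z_def using N by (intro M) auto
    finally show "(\<Sum>j<m. norm (c (j + N) * exp (z * s (j + N)))) \<le> M" .
  qed simp
  then have "summable (\<lambda>j. norm (c j * exp (z * s j)))" by (subst (asm) summable_iff_shift)
  then have sum: "summable (\<lambda>j. exp (D * W) * norm (c j * exp (z * s j)))" by (rule summable_mult)
  show "\<exists>\<rho>\<^sub>0>0. \<forall>\<rho>. 0 < \<rho> \<and> \<rho> \<le> \<rho>\<^sub>0 \<longrightarrow>
      uniformly_convergent_on (sector \<alpha> \<beta> \<rho>) (\<lambda>N x. \<Sum>k<N. c k * exp (s k * L x))"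
  \<comment> \<open>Lowering the argument by at most \<open>W\<close> multiplies the term at \<open>u\<close> by at most \<open>exp ((C * Re u + D) * W)\<close>, and the radius pays for \<open>exp (C * W * Re u)\<close>.\<close>
  proof (intro exI[of _ "exp (\<mu> - C * W)"] conjI allI impI Weierstrass_m_test'_ev[OF _ sum])
    fix \<rho> assume \<rho>: "0 < \<rho> \<and> \<rho> \<le> exp (\<mu> - C * W)"
    have "norm (c j * exp (s j * L x)) \<le> exp (D * W) * norm (c j * exp (z * s j))"
      if j: "N \<le> j" and x: "x \<in> sector \<alpha> \<beta> \<rho>" for j x
    proof (cases "c j = 0")
      case False
      let ?u = "s j"
      have u: "?u \<in> gsupp \<phi>" "T < Re ?u" using False coeff N[OF j] by (auto simp: gsupp_def)
      have xc: "x \<in> open_cone \<alpha> \<beta>" "norm x < \<rho>" using x by (auto simp: sector_def)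
      have "exp (Re (L x)) = norm x"
        using L xc(1) unfolding log_branch_on_def by (metis norm_exp_eq_Re)
      then have "exp (Re (L x)) < exp (\<mu> - C * W)" using xc(2) \<rho> by simp
      then have "Re (L x) - \<mu> \<le> - (C * W)" by simp
      then have "Re ?u * (Re (L x) - \<mu>) \<le> Re ?u * (- (C * W))"
        using u \<open>0 \<le> T\<close> by (intro mult_left_mono) auto
      moreover have "Im ?u * (l - Im (L x)) \<le> (C * Re ?u + D) * W"
      proof -
        have i: "0 \<le> l - Im (L x)" "l - Im (L x) \<le> W" using k[OF xc(1)] l by (auto simp: W_def)
        have "0 \<le> C * Re ?u + D" using CD u(2) \<open>0 \<le> T\<close> by simp
        then show ?thesis
          using mult_right_mono[OF cone[OF u] i(1)] mult_left_mono[OF i(2)] by fastforce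
      qed
      ultimately have "Re (?u * L x) \<le> D * W + Re (z * ?u)"
        by (simp add: z_def algebra_simps)
      then have "norm (exp (?u * L x)) \<le> exp (D * W) * norm (exp (z * ?u))"
        by (simp flip: exp_add)
      from mult_left_mono[OF this, of "norm (c j)"] show ?thesis
        by (simp add: norm_mult mult.left_commute)
    qed simp
    then show "\<forall>\<^sub>F j in sequentially. \<forall>x\<in>sector \<alpha> \<beta> \<rho>.
        norm (c j * exp (s j * L x)) \<le> exp (D * W) * norm (c j * exp (z * s j))"
      unfolding eventually_sequentially by blast
  qed simp
qed

end
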